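(* Let $\mu\in\mathcal{ID}(\boxplus)$ with Lévy measure $\sigma_\mu\neq0$. Then the density $p_{\mu\boxplus\nu}$ is positive and analytic everywhere on $\mathbb{R}$ for every $\nu\in\mathcal{P}_{\mathbb{R}}$ if and only if $$-\lim_{\epsilon\to0^+}\frac{\Im\varphi_\mu(x+i\epsilon)}{\epsilon}=\int_{\mathbb{R}}\frac{1+s^2}{(x-s)^2}\,d\sigma_\mu(s)>1,\quad x\in\mathbb{R},$$ and $$-\lim_{y\to\infty}y\,\Im\varphi_\mu(iy)=\int_{\mathbb{R}}(1+s^2)\,d\sigma_\mu(s)=+\infty.$$
   Context: Notation. $\mathcal{P}_{\mathbb{R}}$ is the set of Borel probability measures on $\mathbb{R}$, $\mathcal{M}_{\mathbb{R}}$ the set of finite positive Borel measures on $\mathbb{R}$, $\mathbb{C}^+$ the open upper half-plane, $\lambda$ Lebesgue measure. For $\nu\in\mathcal{P}_{\mathbb{R}}$, $G_\nu(z)=\int_{\mathbb{R}}\frac{d\nu(s)}{z-s}$ and $F_\nu=1/G_\nu$ on $\mathbb{C}^+$. $\boxplus$ is free additive convolution and $\mathcal{ID}(\boxplus)$ the set of $\boxplus$-infinitely divisible measures in $\mathcal{P}_{\mathbb{R}}$. For $\mu\in\mathcal{ID}(\boxplus)$ the Voiculescu transform $\varphi_\mu(z)=F_\mu^{-1}(z)-z$ (defined first on a truncated cone) extends to $\mathbb{C}^+$ by the free Lévy-Hinčin formula $\varphi_\mu(z)=\gamma_\mu+\int_{\mathbb{R}}\frac{1+sz}{z-s}\,d\sigma_\mu(s)$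 with unique $\gamma_\mu\in\mathbb{R}$ and $\sigma_\mu\in\mathcal{M}_{\mathbb{R}}$; $\sigma_\mu$ is the Lévy measure of $\mu$, and $\sigma_\mu\ne0$ iff $\mu$ is nondegenerate (not a point mass). The density $p_{\mu\boxplus\nu}$. For nondegenerate $\mu\in\mathcal{ID}(\boxplus)$ and $\nu\in\mathcal{P}_{\mathbb{R}}$ put $H(z)=z+\varphi_\mu(F_\nu(z))$, $z\in\mathbb{C}^+$. There are unique $a\in\mathbb{R}$ and $\rho\in\mathcal{M}_{\mathbb{R}}\setminus\{0\}$ with $H(z)=a+z+\int_{\mathbb{R}}\frac{1+sz}{z-s}\,d\rho(s)$. Define $\Omega=\{z\in\mathbb{C}^+:\Im H(z)>0\}$, $f(x)=\inf\{y>0:\int_{\mathbb{R}}\frac{1+s^2}{(x-s)^2+y^2}\,d\rho(s)<1\}$ for $x\in\mathbb{R}$, and $V=\{x\in\mathbb{R}:f(x)>0\}$. It is known that $H$ extends continuously to $\overline{\Omega}$, that $\partial\Omega=\{x+if(x):x\in\mathbb{R}\}$, and that $h(x)=H(x+if(x))$ is a homeomorphism of $\mathbb{R}$ onto $\mathbb{R}$. The density $p_{\mu\boxplus\nu}$ of the absolutely continuous part of $\mu\boxplus\nu$ always means the version of the Radon-Nikodym derivative given by $p_{\mu\boxplus\nu}(h(x))=\frac{f(x)}{\pi}\int_{\mathbb{R}}\frac{d\nu(s)}{(x-s)^2+f(x)^2}$ for $x\in V$ and $p_{\mu\boxplus\nu}(h(x))=0$ for $x\in\mathbb{R}\setminus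 V$. *)

theory Defs
  imports "HOL-Probability.Probability" "HOL-Complex_Analysis.Complex_Analysis"
begin

text \<open>Borel probability measures on the real line are the measures satisfying
  \<^locale>\<open>real_distribution\<close>; finite positive Borel measures are those satisfying
  \<^locale>\<open>finite_borel_measure\<close>.\<close>

definition upper_half_plane :: "complex set" where
  "upper_half_plane = {z. Im z > 0}"

definition cauchy_transform :: "real measure \<Rightarrow> complex \<Rightarrow> complex" where
  "cauchy_transform \<nu> z = (\<integral>s. 1 / (z - complex_of_real s) \<partial>\<nu>)"

definition recip_cauchy :: "real measure \<Rightarrow> complex \<Rightarrow> complex" where
  "recip_cauchy \<nu> z = 1 / cauchy_transform \<nu> z"


subsection \<open>Voiculescu transform, free convolution, infinite divisibility\<close>

definition trunc_cone :: "real \<Rightarrow> real \<Rightarrow> complex set" where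
  "trunc_cone \<alpha> \<beta> = {z. Im z > \<beta> \<and> \<bar>Re z\<bar> < \<alpha> * Im z}"

text \<open>The Voiculescu transform \<open>F\<^sup>-\<^sup>1(z) - z\<close> is a germ at infinity: \<open>F\<close> is injective on some
  truncated cone, the image of which contains a truncated cone, and \<open>F\<^sup>-\<^sup>1\<close> is the inverse of
  that restriction. Since \<open>F(z)/z\<close> tends to 1 as \<open>z\<close> tends to infinity nontangentially, different
  choices of cones give inverses that agree near infinity. The predicate says that \<open>\<phi>\<close> represents
  this germ; nothing is said about \<open>\<phi>\<close> off the cone.\<close>

definition is_voiculescu_transform :: "real measure \<Rightarrow> (complex \<Rightarrow> complex) \<Rightarrow> bool" where
  "is_voiculescu_transform \<mu> \<phi> \<longleftrightarrow>
     (\<exists>\<alpha>>0. \<exists>\<beta>>0. \<exists>\<alpha>'>0. \<exists>\<beta>'>0.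
        inj_on (recip_cauchy \<mu>) (trunc_cone \<alpha> \<beta>) \<and>
        trunc_cone \<alpha>' \<beta>' \<subseteq> recip_cauchy \<mu> ` trunc_cone \<alpha> \<beta> \<and>
        (\<forall>z \<in> trunc_cone \<alpha>' \<beta>'.
           \<phi> z = inv_into (trunc_cone \<alpha> \<beta>) (recip_cauchy \<mu>) z - z))"

text \<open>\<open>is_free_conv \<mu> \<nu> \<tau>\<close> says that \<open>\<tau>\<close> is the free additive convolution of \<open>\<mu>\<close> and \<open>\<nu>\<close>: the
  unique probability measure whose Voiculescu transform is the sum of those of \<open>\<mu>\<close> and \<open>\<nu>\<close> on a
  common truncated cone.\<close>

definition is_free_conv :: "real measure \<Rightarrow> real measure \<Rightarrow> real measure \<Rightarrow> bool" where
  "is_free_conv \<mu> \<nu> \<tau> \<longleftrightarrow>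
     real_distribution \<mu> \<and> real_distribution \<nu> \<and> real_distribution \<tau> \<and>
     (\<exists>\<phi> \<psi>. is_voiculescu_transform \<mu> \<phi> \<and> is_voiculescu_transform \<nu> \<psi> \<and>
             is_voiculescu_transform \<tau> (\<lambda>z. \<phi> z + \<psi> z))"

inductive is_free_power :: "real measure \<Rightarrow> nat \<Rightarrow> real measure \<Rightarrow> bool" for \<nu> where
  one: "real_distribution \<nu> \<Longrightarrow> is_free_power \<nu> 1 \<nu>"
| step: "is_free_power \<nu> n \<tau> \<Longrightarrow> is_free_conv \<tau> \<nu> \<tau>' \<Longrightarrow> is_free_power \<nu> (Suc n) \<tau>'"

definition free_inf_divisible :: "real measure \<Rightarrow> bool" where
  "free_inf_divisible \<mu> \<longleftrightarrow> real_distribution \<mu> \<and> (\<forall>n\<ge>1. \<exists>\<nu>. is_free_power \<nu> n \<mu>)"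

definition levy_integral :: "real measure \<Rightarrow> complex \<Rightarrow> complex" where
  "levy_integral \<sigma> z =
     (\<integral>s. (1 + complex_of_real s * z) / (z - complex_of_real s) \<partial>\<sigma>)"

definition free_levy_phi :: "real \<Rightarrow> real measure \<Rightarrow> complex \<Rightarrow> complex" where
  "free_levy_phi \<gamma> \<sigma> z = complex_of_real \<gamma> + levy_integral \<sigma> z"

text \<open>\<open>\<sigma>\<close> is the Levy measure of \<open>\<mu>\<close> (and \<open>\<gamma>\<close> the accompanying constant), in which case
  \<open>free_levy_phi \<gamma> \<sigma>\<close> is the extension of the Voiculescu transform of \<open>\<mu>\<close> to the upper half-plane.\<close>

definition is_free_levy_pair :: "real measure \<Rightarrow> real \<Rightarrow> real measure \<Rightarrow> bool" where
  "is_free_levy_pair \<mu> \<gamma> \<sigma> \<longleftrightarrow>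
     finite_borel_measure \<sigma> \<and> is_voiculescu_transform \<mu> (free_levy_phi \<gamma> \<sigma>)"


subsection \<open>The density of the free convolution\<close>

text \<open>In the following, \<open>\<phi>\<close> stands for the Voiculescu transform of \<open>\<mu>\<close> on the upper half-plane.\<close>

definition subord_H :: "(complex \<Rightarrow> complex) \<Rightarrow> real measure \<Rightarrow> complex \<Rightarrow> complex" where
  "subord_H \<phi> \<nu> z = z + \<phi> (recip_cauchy \<nu> z)"

text \<open>\<open>subord_rho \<phi> \<nu>\<close> is the unique nonzero finite Borel measure representing \<open>subord_H \<phi> \<nu>\<close>.\<close>

definition subord_rho :: "(complex \<Rightarrow> complex) \<Rightarrow> real measure \<Rightarrow> real measure" where
  "subord_rho \<phi> \<nu> =
     (SOME \<rho>. finite_borel_measure \<rho> \<and> \<rho> \<noteq> null_measure borel \<and>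
        (\<exists>a::real. \<forall>z \<in> upper_half_plane.
           subord_H \<phi> \<nu> z = complex_of_real a + z + levy_integral \<rho> z))"

definition subord_Omega :: "(complex \<Rightarrow> complex) \<Rightarrow> real measure \<Rightarrow> complex set" where
  "subord_Omega \<phi> \<nu> = {z \<in> upper_half_plane. Im (subord_H \<phi> \<nu> z) > 0}"

definition subord_f :: "(complex \<Rightarrow> complex) \<Rightarrow> real measure \<Rightarrow> real \<Rightarrow> real" where
  "subord_f \<phi> \<nu> x =
     Inf {y. y > 0 \<and> (\<integral>s. (1 + s\<^sup>2) / ((x - s)\<^sup>2 + y\<^sup>2) \<partial>subord_rho \<phi> \<nu>) < 1}"

definition subord_V :: "(complex \<Rightarrow> complex) \<Rightarrow> real measure \<Rightarrow> real set" where
  "subord_V \<phi> \<nu> = {x. subord_f \<phi> \<nu> x > 0}"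

text \<open>The point \<open>x + i f(x)\<close> lies on the boundary of \<open>\<Omega>\<close>, and the value there of the continuous
  extension of \<open>H\<close> to the closure of \<open>\<Omega>\<close>, which is real, is the limit of \<open>H\<close> from within \<open>\<Omega>\<close>.
  A limit is needed because \<open>x + i f(x)\<close> is real when \<open>f(x) = 0\<close>.\<close>

definition subord_h :: "(complex \<Rightarrow> complex) \<Rightarrow> real measure \<Rightarrow> real \<Rightarrow> real" where
  "subord_h \<phi> \<nu> x =
     Re (Lim (at (Complex x (subord_f \<phi> \<nu> x)) within subord_Omega \<phi> \<nu>) (subord_H \<phi> \<nu>))"

text \<open>The version of the density of the absolutely continuous part of the free convolution of
  \<open>\<mu>\<close> and \<open>\<nu>\<close> that is prescribed at \<open>h(x)\<close> for real \<open>x\<close>; \<open>h\<close> is a bijection of the real line.\<close>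

definition free_conv_density :: "(complex \<Rightarrow> complex) \<Rightarrow> real measure \<Rightarrow> real \<Rightarrow> real" where
  "free_conv_density \<phi> \<nu> t =
     (let x = inv (subord_h \<phi> \<nu>) t in
      if x \<in> subord_V \<phi> \<nu>
      then subord_f \<phi> \<nu> x / pi * (\<integral>s. 1 / ((x - s)\<^sup>2 + (subord_f \<phi> \<nu> x)\<^sup>2) \<partial>\<nu>)
      else 0)"

definition real_analytic_at :: "(real \<Rightarrow> real) \<Rightarrow> real \<Rightarrow> bool" where
  "real_analytic_at p t \<longleftrightarrow> (\<exists>F. (\<lambda>u. p (t + u)) has_fps_expansion F)"


subsection \<open>The two extended-valued integrals\<close>

text \<open>The quotient is taken in \<^typ>\<open>ennreal\<close>, where a nonzero number divided by 0 is infinite, so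
  that an atom of \<open>\<sigma>\<close> at \<open>x\<close> makes the integral infinite.\<close>

definition boundary_integral :: "real measure \<Rightarrow> real \<Rightarrow> ennreal" where
  "boundary_integral \<sigma> x = (\<integral>\<^sup>+s. ennreal (1 + s\<^sup>2) / ennreal ((x - s)\<^sup>2) \<partial>\<sigma>)"

definition second_moment_integral :: "real measure \<Rightarrow> ennreal" where
  "second_moment_integral \<sigma> = (\<integral>\<^sup>+s. ennreal (1 + s\<^sup>2) \<partial>\<sigma>)"

end

theory Submission
  imports Defs "HOL-Real_Asymp.Real_Asymp"
begin

text \<open>Write \<open>P\<^sub>M(z) = \<integral> (1 + s\<^sup>2) / |z - s|\<^sup>2 dM(s)\<close>, so that \<open>Im \<phi>(z) = - Im z P\<^sub>\<sigma>(z)\<close>. By Fatou's lemma the two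
limits in the theorem hold for every \<open>\<sigma>\<close>, and its content is that the density is positive and
analytic for every \<open>\<nu>\<close> exactly when \<open>f > 0\<close> for every \<open>\<nu>\<close>, and that the latter amounts to the two
conditions on \<open>\<sigma>\<close>.

The measure \<open>\<rho>\<close> exists because \<open>- \<phi> \<circ> F\<close>, with \<open>F = F\<^sub>\<nu>\<close>, maps the upper half-plane into itself:
it has a Nevanlinna representation, obtained from Herglotz's theorem on the disc
(\<open>Herglotz_representation\<close>, \<open>Nevanlinna_representation\<close>), and its linear term vanishes because
\<open>Im \<phi>(F(iy)) = o(y)\<close> (\<open>ex_representing_measure\<close>).

The map \<open>H(z) = a + z + \<integral> (1 + sz) / (z - s) d\<rho>(s)\<close> satisfies \<open>H(z) - H(w) = (z - w)(1 - Q(z, w))\<close>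
with \<open>Q(z, w) = \<integral> (1 + s\<^sup>2) / ((z - s)(w - s)) d\<rho>(s)\<close>. Since \<open>|Q(z, w)| \<le> (P\<^sub>\<rho>(z) + P\<^sub>\<rho>(w)) / 2\<close>, and
\<open>Re Q(z, w)\<close> is even strictly smaller unless \<open>z = w\<close> is real, everything that is needed about \<open>H\<close> on the set \<open>P\<^sub>\<rho> \<le> 1\<close>, which
includes the curve \<open>x + i f(x)\<close> also where it touches the real axis, follows from this identity:
\<open>H\<close> is Lipschitz there, so that the limits defining \<open>h\<close> exist; \<open>H\<close> is injective there, so that \<open>h\<close> is
injective; \<open>H' \<noteq> 0\<close> on the part of the curve above the axis; and \<open>H\<close> is proper. If \<open>f > 0\<close>
everywhere, the range of \<open>h\<close> is therefore open and closed, hence all of \<open>\<real>\<close>, and the density is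
\<open>- Im G\<^sub>\<nu>(g(t)) / \<pi>\<close> for a local holomorphic inverse \<open>g\<close> of \<open>H\<close>, which is positive and analytic. If
\<open>f(x) = 0\<close> then the density vanishes at \<open>h(x)\<close>.

It remains to decide when \<open>f > 0\<close>. The identity \<open>Im z P\<^sub>\<rho>(z) = Im F(z) P\<^sub>\<sigma>(F(z))\<close> turns \<open>f(x) = 0\<close> into
\<open>Im F(x + iy) P\<^sub>\<sigma>(F(x + iy)) < y\<close> for all \<open>y > 0\<close>. Suppose this, and let \<open>y\<close> tend to 0. A limit point
of \<open>F(x + iy)\<close> in the upper half-plane is impossible; a real limit point \<open>w\<close> gives
\<open>\<integral> (1 + s\<^sup>2) / (w - s)\<^sup>2 d\<sigma>(s) \<le> 1\<close>, because \<open>Im F(z) \<ge> Im z\<close>; and if \<open>F\<close> is unbounded, Fatou's lemma gives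
\<open>\<integral> (1 + s\<^sup>2) d\<sigma>(s) < \<infinity>\<close> (\<open>height_pos_if_levy_conditions\<close>). Conversely, if the first condition fails
then \<open>\<nu> = \<delta>\<^sub>0\<close>, for which \<open>F(z) = z\<close>, has \<open>f(x) = 0\<close> for some \<open>x\<close>; if the second fails then
\<open>\<nu> = (\<delta>\<^sub>c + \<delta>\<^sub>-\<^sub>c) / 2\<close>, for which \<open>F(z) = z - c\<^sup>2 / z\<close>, has \<open>f(0) = 0\<close> as soon as \<open>c\<^sup>2\<close> is at least the
integral (\<open>levy_conditions_if_densities_pos\<close>).\<close>

section \<open>Poisson integrals and the Cauchy and Levy kernels\<close>

definition poisson_kernel :: "complex \<Rightarrow> real \<Rightarrow> real" where
  "poisson_kernel z s = (1 + s\<^sup>2) / (cmod (z - of_real s))\<^sup>2"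

definition poisson_int :: "real measure \<Rightarrow> complex \<Rightarrow> real" where
  "poisson_int M z = (\<integral>s. poisson_kernel z s \<partial>M)"

lemma cmod_diff_real_sq: "(cmod (z - of_real s))\<^sup>2 = (Re z - s)\<^sup>2 + (Im z)\<^sup>2"
  by (simp add: cmod_power2)

lemma poisson_kernel_Complex: "poisson_kernel (Complex x y) s = (1 + s\<^sup>2) / ((x - s)\<^sup>2 + y\<^sup>2)"
  by (simp add: poisson_kernel_def cmod_diff_real_sq)

lemma poisson_kernel_nonneg [simp]: "0 \<le> poisson_kernel z s"
  by (simp add: poisson_kernel_def)

lemma one_plus_sq_pos: "0 < 1 + (s::real)\<^sup>2"
  by (simp add: add_pos_nonneg)

lemma poisson_kernel_pos: "z \<noteq> of_real s \<Longrightarrow> 0 < poisson_kernel z s"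
  by (simp add: poisson_kernel_def one_plus_sq_pos)

lemma in_upper_half_plane [simp]: "z \<in> upper_half_plane \<longleftrightarrow> 0 < Im z"
  by (simp add: upper_half_plane_def)

lemma open_upper_half_plane: "open upper_half_plane"
  unfolding upper_half_plane_def by (rule open_halfspace_Im_gt)

lemma upper_ne_real: "0 < Im z \<Longrightarrow> z \<noteq> of_real s"
  by auto

lemma Im_le_cmod_diff_real: "Im z \<le> cmod (z - of_real s)"
  using abs_Im_le_cmod[of "z - of_real s"] by simp

lemma Im_inverse_diff_real: "Im (1 / (z - of_real s)) = - Im z / (cmod (z - of_real s))\<^sup>2"
  by (simp add: Im_divide cmod_power2)

text \<open>The integrand of the Levy integral differs from a multiple of the Cauchy kernel by a term that does
not depend on \<open>s\<close>. Regularity of Levy integrals therefore follows from that of Cauchy transforms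
of finite measures.\<close>

lemma levy_kernel_eq:
  "z \<noteq> complex_of_real s \<Longrightarrow>
     (1 + of_real s * z) / (z - of_real s) = (1 + z\<^sup>2) * (1 / (z - of_real s)) - z"
  by (simp add: divide_simps) (simp add: algebra_simps power2_eq_square)

lemma Im_levy_kernel:
  "Im ((1 + of_real s * z) / (z - of_real s)) = - Im z * poisson_kernel z s"
proof -
  have "Im ((1 + of_real s * z) / (z - of_real s)) =
     (s * Im z * (Re z - s) - (1 + s * Re z) * Im z) / (cmod (z - of_real s))\<^sup>2"
    by (simp add: Im_divide cmod_power2)
  also have "s * Im z * (Re z - s) - (1 + s * Re z) * Im z = - Im z * (1 + s\<^sup>2)"
    by (simp add: algebra_simps power2_eq_square)
  finally show ?thesis by (simp add: poisson_kernel_def)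
qed

lemma borel_measurable_poisson_kernel [measurable]: "poisson_kernel z \<in> borel_measurable borel"
  unfolding poisson_kernel_def by measurable

context finite_borel_measure
begin

declare M_is_borel [measurable_cong]

lemma space_UNIV: "space M = UNIV"
  using sets_eq_imp_space_eq[OF M_is_borel] by simp

lemma integrable_cauchy_kernel:
  assumes "0 < Im z"
  shows "integrable M (\<lambda>s. 1 / (z - complex_of_real s))"
proof (rule integrable_const_bound[of _ "1 / Im z"])
  show "AE s in M. cmod (1 / (z - complex_of_real s)) \<le> 1 / Im z"
    using assms Im_le_cmod_diff_real[of z] upper_ne_real[OF assms]
    by (auto simp: norm_divide intro!: AE_I2 divide_left_mono mult_pos_pos)
qed measurable

lemma integrable_levy_kernel:
  assumes "0 < Im z"
  shows "integrable M (\<lambda>s. (1 + of_real s * z) / (z - of_real s))"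
  by (simp add: levy_kernel_eq[OF upper_ne_real[OF assms]] integrable_cauchy_kernel[OF assms]
      del: times_divide_eq_right)

lemma levy_integral_eq_cauchy:
  assumes "0 < Im z"
  shows "levy_integral M z = (1 + z\<^sup>2) * cauchy_transform M z - of_real (measure M UNIV) * z"
  using integrable_cauchy_kernel[OF assms]
  by (simp add: levy_integral_def cauchy_transform_def levy_kernel_eq[OF upper_ne_real[OF assms]]
      scaleR_conv_of_real space_UNIV del: times_divide_eq_right)

lemma integrable_poisson_kernel:
  assumes "0 < Im z"
  shows "integrable M (poisson_kernel z)"
proof -
  have "integrable M (\<lambda>s. - Im ((1 + of_real s * z) / (z - of_real s)) / Im z)"
    using integrable_levy_kernel[OF assms] by (intro integrable_divide integrable_minus integrable_Im)
  then show ?thesis using assms unfolding Im_levy_kernel by simp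
qed

lemma Im_levy_integral:
  assumes "0 < Im z"
  shows "Im (levy_integral M z) = - Im z * poisson_int M z"
proof -
  have "Im (levy_integral M z) = (\<integral>s. Im ((1 + of_real s * z) / (z - of_real s)) \<partial>M)"
    unfolding levy_integral_def using integral_Im[OF integrable_levy_kernel[OF assms]] by simp
  then show ?thesis by (simp add: Im_levy_kernel poisson_int_def del: Im_divide)
qed

text \<open>The difference quotient minus the asserted derivative is the integral of
\<open>(w - z) / ((z - s)\<^sup>2 (w - s))\<close>, which is \<open>O(w - z)\<close> because \<open>|z - s|\<close> and \<open>|w - s|\<close> stay above \<open>Im z / 2\<close>.\<close>

lemma cauchy_transform_has_derivative:
  assumes "0 < Im z"
  shows "(cauchy_transform M has_field_derivative - (\<integral>s. 1 / (z - of_real s)\<^sup>2 \<partial>M)) (at z)"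
proof -
  define c where "c = Im z / 2"
  have c: "0 < c" "c < Im z" using assms by (auto simp: c_def)
  have int2: "integrable M (\<lambda>s. 1 / (z - of_real s)\<^sup>2)"
  proof (rule integrable_const_bound[of _ "1 / (Im z)\<^sup>2"])
    show "AE s in M. cmod (1 / (z - complex_of_real s)\<^sup>2) \<le> 1 / (Im z)\<^sup>2"
      using assms Im_le_cmod_diff_real[of z] upper_ne_real[OF assms]
      by (auto simp: norm_divide norm_power intro!: AE_I2 divide_left_mono power_mono)
  qed measurable
  have bound: "cmod ((cauchy_transform M w - cauchy_transform M z) / (w - z) -
        - (\<integral>s. 1 / (z - of_real s)\<^sup>2 \<partial>M)) \<le> cmod (w - z) * (measure M UNIV / c ^ 3)"
    if w: "c < Im w" "w \<noteq> z" for w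
  proof -
    have pw: "0 < Im w" using w c by auto
    have intd: "integrable M (\<lambda>s. (1 / (w - of_real s) - 1 / (z - of_real s)) / (w - z))"
      by (intro integrable_divide Bochner_Integration.integrable_diff integrable_cauchy_kernel pw assms)
    have eq: "(cauchy_transform M w - cauchy_transform M z) / (w - z) - - (\<integral>s. 1 / (z - of_real s)\<^sup>2 \<partial>M)
       = (\<integral>s. (1 / (w - of_real s) - 1 / (z - of_real s)) / (w - z) + 1 / (z - of_real s)\<^sup>2 \<partial>M)"
      unfolding cauchy_transform_def
      using integrable_cauchy_kernel[OF pw] integrable_cauchy_kernel[OF assms] int2 intd
      by (subst Bochner_Integration.integral_add) auto
    have pt: "(1 / (w - of_real s) - 1 / (z - of_real s)) / (w - z) + 1 / (z - of_real s)\<^sup>2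
        = (w - z) / ((z - of_real s)\<^sup>2 * (w - of_real s))" for s
      using upper_ne_real[OF pw, of s] upper_ne_real[OF assms, of s] w(2)
      by (simp add: divide_simps) (simp add: algebra_simps power2_eq_square)
    have "cmod (\<integral>s. (w - z) / ((z - of_real s)\<^sup>2 * (w - of_real s)) \<partial>M)
        \<le> (\<integral>s. cmod (w - z) / c ^ 3 \<partial>M)"
    proof (rule Bochner_Integration.integral_norm_bound_integral)
      show "integrable M (\<lambda>s. (w - z) / ((z - of_real s)\<^sup>2 * (w - of_real s)))"
        using intd int2 unfolding pt[symmetric] by (rule Bochner_Integration.integrable_add)
      fix s
      have "c ^ 3 \<le> (cmod (z - of_real s))\<^sup>2 * cmod (w - of_real s)"
        unfolding power3_eq_cube power2_eq_square
        using c w Im_le_cmod_diff_real[of z s] Im_le_cmod_diff_real[of w s]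
        by (intro mult_mono) auto
      then show "cmod ((w - z) / ((z - of_real s)\<^sup>2 * (w - of_real s))) \<le> cmod (w - z) / c ^ 3"
        unfolding norm_divide norm_mult norm_power using c(1) by (intro frac_le) auto
    qed simp
    then show ?thesis unfolding eq pt by (simp add: space_UNIV mult.commute)
  qed
  have ev: "\<forall>\<^sub>F w in at z. c < Im w \<and> w \<noteq> z"
  proof -
    have "\<forall>\<^sub>F w in at z. c < Im w"
      using c by (intro order_tendstoD(1)[OF tendsto_Im[OF tendsto_ident_at]])
    then show ?thesis by (auto simp: eventually_conj_iff eventually_at_filter elim: eventually_mono)
  qed
  have lim0: "((\<lambda>w. cmod (w - z) * (measure M UNIV / c ^ 3)) \<longlongrightarrow> 0) (at z)"
    using c by (auto intro!: tendsto_eq_intros)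
  have "((\<lambda>w. (cauchy_transform M w - cauchy_transform M z) / (w - z) -
        - (\<integral>s. 1 / (z - of_real s)\<^sup>2 \<partial>M)) \<longlongrightarrow> 0) (at z)"
    by (rule Lim_null_comparison[OF eventually_mono[OF ev] lim0]) (use bound in blast)
  then show ?thesis
    unfolding has_field_derivative_iff by (subst (asm) LIM_zero_iff)
qed

lemma cauchy_transform_holomorphic: "cauchy_transform M holomorphic_on upper_half_plane"
  unfolding holomorphic_on_open[OF open_upper_half_plane]
  using cauchy_transform_has_derivative by auto blast

lemma levy_integral_holomorphic: "levy_integral M holomorphic_on upper_half_plane"
proof -
  have "(\<lambda>z. (1 + z\<^sup>2) * cauchy_transform M z - of_real (measure M UNIV) * z)
      holomorphic_on upper_half_plane"
    by (intro holomorphic_intros cauchy_transform_holomorphic)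
  then show ?thesis
    by (rule holomorphic_transform) (simp add: levy_integral_eq_cauchy)
qed

lemma poisson_int_eq: "0 < Im z \<Longrightarrow> poisson_int M z = - Im (levy_integral M z) / Im z"
  by (simp add: Im_levy_integral)

lemma poisson_int_continuous: "continuous_on upper_half_plane (poisson_int M)"
proof -
  have "continuous_on upper_half_plane (\<lambda>z. - Im (levy_integral M z) / Im z)"
    by (intro continuous_intros holomorphic_on_imp_continuous_on levy_integral_holomorphic) auto
  then show ?thesis by (rule continuous_on_eq) (simp add: poisson_int_eq)
qed

lemma poisson_int_nonneg: "0 \<le> poisson_int M z"
  unfolding poisson_int_def by (intro Bochner_Integration.integral_nonneg) simp

lemma poisson_int_tendsto:
  assumes "(Z \<longlongrightarrow> z) F" "0 < Im z"
  shows "((\<lambda>n. poisson_int M (Z n)) \<longlongrightarrow> poisson_int M z) F"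
  using poisson_int_continuous assms open_upper_half_plane
  by (auto simp: continuous_on_eq_continuous_at intro: isCont_tendsto_compose)

lemma emeasure_space_nonzero:
  assumes "M \<noteq> null_measure borel"
  shows "emeasure M (space M) \<noteq> 0"
proof
  assume 0: "emeasure M (space M) = 0"
  have "M = null_measure borel"
  proof (rule measure_eqI)
    fix A assume A: "A \<in> sets M"
    then have "emeasure M A \<le> emeasure M (space M)" by (intro emeasure_mono) (auto dest: sets.sets_into_space)
    then show "emeasure M A = emeasure (null_measure borel) A" using 0 by simp
  qed (simp add: M_is_borel)
  with assms show False by simp
qed

lemma poisson_int_pos:
  assumes "M \<noteq> null_measure borel" "0 < Im z"
  shows "0 < poisson_int M z"
proof -
  have "(\<integral>s. 0 \<partial>M) < (\<integral>s. poisson_kernel z s \<partial>M)"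
    using assms upper_ne_real[OF assms(2)]
    by (intro integral_less_AE_space integrable_poisson_kernel emeasure_space_nonzero)
      (auto intro: poisson_kernel_pos)
  then show ?thesis by (simp add: poisson_int_def)
qed

lemma poisson_int_strict_antimono:
  assumes "M \<noteq> null_measure borel" "0 < y" "y < y'"
  shows "poisson_int M (Complex x y') < poisson_int M (Complex x y)"
  unfolding poisson_int_def
proof (intro integral_less_AE_space integrable_poisson_kernel emeasure_space_nonzero assms)
  have "poisson_kernel (Complex x y') s < poisson_kernel (Complex x y) s" for s
  proof -
    have "y\<^sup>2 < y'\<^sup>2" using assms by (intro power_strict_mono) auto
    moreover have "0 < y\<^sup>2" using assms by simp
    ultimately show ?thesis unfolding poisson_kernel_Complex
      by (intro divide_strict_left_mono mult_pos_pos add_nonneg_pos one_plus_sq_pos) auto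
  qed
  then show "AE s in M. poisson_kernel (Complex x y') s < poisson_kernel (Complex x y) s" by simp
qed (use assms in auto)

lemma poisson_int_tendsto_0: "((\<lambda>y. poisson_int M (Complex x y)) \<longlongrightarrow> 0) at_top"
proof -
  have "((\<lambda>y. \<integral>s. poisson_kernel (Complex x y) s \<partial>M) \<longlongrightarrow> (\<integral>s. 0 \<partial>M)) at_top"
  proof (rule integral_dominated_convergence_at_top)
    show "integrable M (poisson_kernel (Complex x 1))" by (rule integrable_poisson_kernel) simp
    have "norm (poisson_kernel (Complex x y) s) \<le> poisson_kernel (Complex x 1) s" if "y \<ge> 1" for y s
    proof -
      have "1 \<le> y\<^sup>2" using that by simp
      then show ?thesis unfolding poisson_kernel_Complex
        by (auto intro!: divide_left_mono mult_pos_pos add_nonneg_pos)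
    qed
    then show "\<forall>\<^sub>F y in at_top. AE s in M. norm (poisson_kernel (Complex x y) s) \<le> poisson_kernel (Complex x 1) s"
      by (intro eventually_at_top_linorderI[of 1]) auto
    have "((\<lambda>y. (1 + s\<^sup>2) / ((x - s)\<^sup>2 + y\<^sup>2)) \<longlongrightarrow> 0) at_top" for s :: real
      by real_asymp
    then show "AE s in M. ((\<lambda>y. poisson_kernel (Complex x y) s) \<longlongrightarrow> 0) at_top"
      by (simp add: poisson_kernel_Complex)
  qed measurable
  then show ?thesis by (simp add: poisson_int_def)
qed

end

section \<open>Limits of the Poisson integral at the real axis and at infinity\<close>

text \<open>Fatou's lemma bounds the limit from below, the pointwise bound from above. Along an arbitrary sequence
of points that tends to the boundary the kernels are bounded by their limit, but need not increase.\<close>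

lemma nn_integral_tendsto_from_below:
  fixes u :: "nat \<Rightarrow> 'a \<Rightarrow> ennreal"
  assumes [measurable]: "\<And>n. u n \<in> borel_measurable M"
    and le: "\<And>n x. u n x \<le> f x" and lim: "\<And>x. (\<lambda>n. u n x) \<longlonglongrightarrow> f x"
  shows "(\<lambda>n. integral\<^sup>N M (u n)) \<longlonglongrightarrow> integral\<^sup>N M f"
proof -
  have "integral\<^sup>N M f = (\<integral>\<^sup>+x. liminf (\<lambda>n. u n x) \<partial>M)"
    by (simp add: lim_imp_Liminf[OF sequentially_bot lim])
  also have "\<dots> \<le> liminf (\<lambda>n. integral\<^sup>N M (u n))"
    by (intro nn_integral_liminf) measurable
  finally have 1: "integral\<^sup>N M f \<le> liminf (\<lambda>n. integral\<^sup>N M (u n))" .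
  have 2: "limsup (\<lambda>n. integral\<^sup>N M (u n)) \<le> integral\<^sup>N M f"
    by (intro Limsup_bounded always_eventually allI nn_integral_mono le)
  have 3: "liminf (\<lambda>n. integral\<^sup>N M (u n)) \<le> limsup (\<lambda>n. integral\<^sup>N M (u n))"
    by (intro Liminf_le_Limsup sequentially_bot)
  show ?thesis
    unfolding tendsto_iff_Liminf_eq_Limsup[OF sequentially_bot]
    using 1 2 3 by (auto intro!: antisym elim: order_trans)
qed

lemma tendsto_ennreal_top:
  assumes "filterlim g at_top F"
  shows "((\<lambda>x. ennreal (g x)) \<longlongrightarrow> top) F"
  unfolding tendsto_top_iff_ennreal
proof safe
  fix l :: real assume "0 \<le> l"
  have "\<forall>\<^sub>F x in F. l < g x" using assms by (simp add: filterlim_at_top_dense)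
  then show "\<forall>\<^sub>F x in F. ennreal l < ennreal (g x)"
    using \<open>0 \<le> l\<close> by (auto elim!: eventually_mono intro: ennreal_lessI)
qed

lemma tendsto_uminus_enn2ereal:
  assumes "((\<lambda>x. ennreal (g x)) \<longlongrightarrow> L) F" "\<forall>\<^sub>F x in F. 0 \<le> g x \<and> h x = - g x"
  shows "((\<lambda>x. ereal (h x)) \<longlongrightarrow> - enn2ereal L) F"
proof -
  have "((\<lambda>x. - enn2ereal (ennreal (g x))) \<longlongrightarrow> - enn2ereal L) F"
    by (intro tendsto_intros assms)
  then show ?thesis
    by (rule Lim_transform_eventually) (use assms(2) in \<open>auto elim!: eventually_mono simp: enn2ereal_ennreal\<close>)
qed

lemma boundary_kernel_tendsto:
  assumes "Y \<longlonglongrightarrow> 0" "\<And>n. 0 < Y n"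
  shows "(\<lambda>n. ennreal (poisson_kernel (Complex x (Y n)) s))
     \<longlonglongrightarrow> ennreal (1 + s\<^sup>2) / ennreal ((x - s)\<^sup>2)"
proof (cases "s = x")
  case True
  have "filterlim (\<lambda>n. (1 + s\<^sup>2) / (Y n)\<^sup>2) at_top sequentially"
    using assms tendsto_power[OF assms(1), of 2]
    by (intro LIM_at_top_divide[OF tendsto_const one_plus_sq_pos]) (auto simp: less_imp_neq[symmetric])
  then show ?thesis
    using True one_plus_sq_pos[of s]
    by (simp add: poisson_kernel_Complex tendsto_ennreal_top ennreal_eq_0_iff)
next
  case False
  have "(\<lambda>n. ennreal ((1 + s\<^sup>2) / ((x - s)\<^sup>2 + (Y n)\<^sup>2))) \<longlonglongrightarrow> ennreal ((1 + s\<^sup>2) / ((x - s)\<^sup>2 + 0\<^sup>2))"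
    using False by (intro tendsto_intros assms) auto
  then show ?thesis using False
    by (simp add: poisson_kernel_Complex divide_ennreal del: ennreal_plus)
qed

lemma boundary_kernel_ge:
  assumes "0 < y"
  shows "ennreal (poisson_kernel (Complex x y) s) \<le> ennreal (1 + s\<^sup>2) / ennreal ((x - s)\<^sup>2)"
proof (cases "s = x")
  case True
  then show ?thesis using one_plus_sq_pos[of s] by (simp add: ennreal_eq_0_iff)
next
  case False
  have "(1 + s\<^sup>2) / ((x - s)\<^sup>2 + y\<^sup>2) \<le> (1 + s\<^sup>2) / (x - s)\<^sup>2"
    using False assms by (intro divide_left_mono mult_pos_pos) (auto simp: add_pos_nonneg)
  then show ?thesis using False
    by (simp add: poisson_kernel_Complex divide_ennreal ennreal_leI del: ennreal_plus)
qed

context finite_borel_measure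
begin

lemma nn_integral_poisson_kernel:
  "0 < Im z \<Longrightarrow> (\<integral>\<^sup>+s. ennreal (poisson_kernel z s) \<partial>M) = ennreal (poisson_int M z)"
  unfolding poisson_int_def by (intro nn_integral_eq_integral integrable_poisson_kernel) auto

lemma poisson_int_le_boundary_integral:
  assumes "0 < y"
  shows "ennreal (poisson_int M (Complex x y)) \<le> boundary_integral M x"
  unfolding boundary_integral_def using assms
  by (subst nn_integral_poisson_kernel[symmetric]) (auto intro!: nn_integral_mono boundary_kernel_ge simp del: ennreal_plus)

lemma poisson_int_tendsto_boundary_integral:
  "((\<lambda>y. ennreal (poisson_int M (Complex x y))) \<longlongrightarrow> boundary_integral M x) (at_right 0)"
proof (rule tendsto_at_right_sequentially[of 0 1])
  fix Y :: "nat \<Rightarrow> real" assume Y: "\<And>n. 0 < Y n" "Y \<longlonglongrightarrow> 0"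
  have "(\<lambda>n. \<integral>\<^sup>+s. ennreal (poisson_kernel (Complex x (Y n)) s) \<partial>M)
     \<longlonglongrightarrow> (\<integral>\<^sup>+s. ennreal (1 + s\<^sup>2) / ennreal ((x - s)\<^sup>2) \<partial>M)"
    using Y by (intro nn_integral_tendsto_from_below boundary_kernel_tendsto boundary_kernel_ge) auto
  then show "(\<lambda>n. ennreal (poisson_int M (Complex x (Y n)))) \<longlonglongrightarrow> boundary_integral M x"
    using Y by (simp add: nn_integral_poisson_kernel boundary_integral_def)
qed simp

text \<open>Arguments that approach the real axis arrive at bounds for the Poisson integral along a vertical
line; in this way they pass to the integral at its foot.\<close>

lemma poisson_int_le_imp_boundary_integral_le:
  assumes "\<And>y. 0 < y \<Longrightarrow> poisson_int M (Complex x y) \<le> c"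
  shows "boundary_integral M x \<le> ennreal c"
  by (rule tendsto_upperbound[OF poisson_int_tendsto_boundary_integral])
    (use assms in \<open>auto simp: eventually_at_filter ennreal_leI\<close>)

lemma scaled_poisson_int_tendsto_second_moment:
  "((\<lambda>y. ennreal (y\<^sup>2 * poisson_int M (Complex 0 y))) \<longlongrightarrow> second_moment_integral M) at_top"
proof (rule tendsto_at_topI_sequentially)
  fix Y :: "nat \<Rightarrow> real" assume Y: "filterlim Y at_top sequentially"
  have "(\<lambda>n. \<integral>\<^sup>+s. ennreal ((Y n)\<^sup>2 * poisson_kernel (Complex 0 (Y n)) s) \<partial>M)
     \<longlonglongrightarrow> (\<integral>\<^sup>+s. ennreal (1 + s\<^sup>2) \<partial>M)"
  proof (intro nn_integral_tendsto_from_below ennreal_leI)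
    fix n s
    have "(Y n)\<^sup>2 * (1 + s\<^sup>2) / (s\<^sup>2 + (Y n)\<^sup>2) \<le> 1 + s\<^sup>2"
    proof (cases "s\<^sup>2 + (Y n)\<^sup>2 = 0")
      case False
      then have "0 < s\<^sup>2 + (Y n)\<^sup>2" by (metis add_nonneg_nonneg less_eq_real_def zero_le_power2)
      then show ?thesis by (simp add: pos_divide_le_eq) (simp add: algebra_simps)
    qed (simp add: add_nonneg_nonneg)
    then show "(Y n)\<^sup>2 * poisson_kernel (Complex 0 (Y n)) s \<le> 1 + s\<^sup>2"
      by (simp add: poisson_kernel_Complex)
  next
    fix s :: real
    have "((\<lambda>y. y\<^sup>2 * ((1 + s\<^sup>2) / (s\<^sup>2 + y\<^sup>2))) \<longlongrightarrow> 1 + s\<^sup>2) at_top" by real_asymp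
    from filterlim_compose[OF this Y]
    show "(\<lambda>n. ennreal ((Y n)\<^sup>2 * poisson_kernel (Complex 0 (Y n)) s)) \<longlonglongrightarrow> ennreal (1 + s\<^sup>2)"
      by (intro tendsto_ennrealI) (simp add: poisson_kernel_Complex)
  qed measurable
  moreover have "\<forall>\<^sub>F n in sequentially. (\<integral>\<^sup>+s. ennreal ((Y n)\<^sup>2 * poisson_kernel (Complex 0 (Y n)) s) \<partial>M)
      = ennreal ((Y n)\<^sup>2 * poisson_int M (Complex 0 (Y n)))"
    using filterlim_at_top_dense[THEN iffD1, OF Y, rule_format, of 0]
    by eventually_elim (simp add: ennreal_mult nn_integral_cmult nn_integral_poisson_kernel poisson_int_nonneg)
  ultimately show "(\<lambda>n. ennreal ((Y n)\<^sup>2 * poisson_int M (Complex 0 (Y n)))) \<longlonglongrightarrow> second_moment_integral M"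
    unfolding second_moment_integral_def by (rule Lim_transform_eventually)
qed

lemma Im_free_levy_phi:
  "0 < Im z \<Longrightarrow> Im (free_levy_phi \<gamma> M z) = - Im z * poisson_int M z"
  by (simp add: free_levy_phi_def Im_levy_integral)

lemma free_levy_phi_boundary_limit:
  "((\<lambda>\<epsilon>. ereal (Im (free_levy_phi \<gamma> M (Complex x \<epsilon>)) / \<epsilon>)) \<longlongrightarrow> - enn2ereal (boundary_integral M x)) (at_right 0)"
  by (rule tendsto_uminus_enn2ereal[OF poisson_int_tendsto_boundary_integral])
    (auto simp: eventually_at_filter Im_free_levy_phi poisson_int_nonneg)

lemma free_levy_phi_limit_at_infinity:
  "((\<lambda>y. ereal (y * Im (free_levy_phi \<gamma> M (Complex 0 y)))) \<longlongrightarrow> - enn2ereal (second_moment_integral M)) at_top"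
  by (rule tendsto_uminus_enn2ereal[OF scaled_poisson_int_tendsto_second_moment])
    (auto intro!: eventually_at_top_linorderI[of 1] simp: Im_free_levy_phi poisson_int_nonneg power2_eq_square)

end

section \<open>The Nevanlinna representation\<close>

text \<open>The circle is parametrized by \<open>t \<in> [0, 1]\<close> as in \<^const>\<open>circlepath\<close>. Measures on the circle are
represented by measures on the real line, so that Helly's theorem on distribution functions
yields weak limits; the integrands are functions of the point of the circle, hence periodic in \<open>t\<close>.\<close>

definition circle_pt :: "real \<Rightarrow> complex" where
  "circle_pt t = exp (2 * of_real pi * \<i> * of_real t)"

lemma norm_circle_pt [simp]: "cmod (circle_pt t) = 1"
  by (simp add: circle_pt_def)

lemma circle_pt_nonzero [simp]: "circle_pt t \<noteq> 0"
  by (simp add: circle_pt_def)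

lemma cnj_circle_pt: "cnj (circle_pt t) = 1 / circle_pt t"
  unfolding circle_pt_def exp_cnj by (simp add: exp_minus inverse_eq_divide)

lemma continuous_on_circle_pt [continuous_intros]: "continuous_on A circle_pt"
  unfolding circle_pt_def by (intro continuous_intros)

lemma circle_pt_ne_inside: "cmod z < 1 \<Longrightarrow> circle_pt t \<noteq> z"
  using norm_circle_pt[of t] by auto

lemma Cauchy_formula_unit_circle:
  assumes "continuous_on (cball 0 1) f" "f holomorphic_on ball 0 1" "cmod z < 1"
  shows "((\<lambda>t. f (circle_pt t) * (circle_pt t / (circle_pt t - z))) has_integral f z) {0..1}"
proof -
  have "((\<lambda>u. f u / (u - z)) has_contour_integral (2 * of_real pi * \<i> * f z)) (circlepath 0 1)"
    using assms by (intro Cauchy_integral_circlepath) auto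
  then have "((\<lambda>t. f (circle_pt t) / (circle_pt t - z) * (2 * of_real pi * \<i> * circle_pt t))
      has_integral (2 * of_real pi * \<i> * f z)) {0..1}"
    unfolding has_contour_integral_def
    by (rule has_integral_eq[rotated])
      (simp add: vector_derivative_circlepath01, simp add: circlepath circle_pt_def)
  from has_integral_mult_right[OF this, of "1 / (2 * of_real pi * \<i>)"]
  show ?thesis by (simp add: field_simps)
qed

text \<open>The real part is the mean of \<open>f\<close> and its conjugate. Cauchy's formula evaluates the integral of
\<open>f\<close>; on the circle, conjugation turns the kernel into a function holomorphic inside, so the
conjugate only contributes its value at the origin.\<close>

lemma Schwarz_integral_formula:
  assumes cont: "continuous_on (cball 0 1) f" and hol: "f holomorphic_on ball 0 1" and z: "cmod z < 1"
  shows "((\<lambda>t. of_real (Re (f (circle_pt t))) * ((circle_pt t + z) / (circle_pt t - z)))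
      has_integral (f z - \<i> * of_real (Im (f 0)))) {0..1}"
proof -
  have den: "1 - cnj z * w \<noteq> 0" if "cmod w \<le> 1" for w
  proof
    assume "1 - cnj z * w = 0"
    then have "cmod (cnj z * w) = 1" by (metis eq_iff_diff_eq_0 norm_one)
    then have "cmod z * cmod w = 1" by (simp add: norm_mult)
    moreover have "cmod z * cmod w \<le> cmod z * 1" using that by (intro mult_left_mono) auto
    ultimately show False using z by simp
  qed
  have I1: "((\<lambda>t. f (circle_pt t) * (circle_pt t / (circle_pt t - z))) has_integral f z) {0..1}"
    by (rule Cauchy_formula_unit_circle[OF cont hol z])
  have I0: "((\<lambda>t. f (circle_pt t)) has_integral f 0) {0..1}"
    using Cauchy_formula_unit_circle[OF cont hol, of 0] by simp
  \<comment> \<open>The conjugate of \<open>f\<close> is integrated against the reflected kernel, to which the mean value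
    property at the origin applies.\<close>
  have "((\<lambda>t. f (circle_pt t) / (1 - cnj z * circle_pt t) * (circle_pt t / (circle_pt t - 0)))
      has_integral f 0 / (1 - cnj z * 0)) {0..1}"
    using den by (intro Cauchy_formula_unit_circle continuous_intros holomorphic_intros cont hol) auto
  then have "((\<lambda>t. cnj (f (circle_pt t) / (1 - cnj z * circle_pt t))) has_integral cnj (f 0)) {0..1}"
    by (subst has_integral_cnj[unfolded o_def]) simp
  moreover have "cnj (f (circle_pt t) / (1 - cnj z * circle_pt t))
      = cnj (f (circle_pt t)) * (circle_pt t / (circle_pt t - z))" for t
    using circle_pt_ne_inside[OF z, of t] den[of "circle_pt t"]
    by (simp add: cnj_circle_pt divide_simps)
  ultimately have I2: "((\<lambda>t. cnj (f (circle_pt t)) * (circle_pt t / (circle_pt t - z)))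
      has_integral cnj (f 0)) {0..1}" by simp
  have I3: "((\<lambda>t. cnj (f (circle_pt t))) has_integral cnj (f 0)) {0..1}"
    by (subst has_integral_cnj[unfolded o_def]) (rule I0)
  have sum: "((\<lambda>t. (f (circle_pt t) * (circle_pt t / (circle_pt t - z))
        + cnj (f (circle_pt t)) * (circle_pt t / (circle_pt t - z)))
        - (f (circle_pt t) + cnj (f (circle_pt t))) * (1 / 2))
      has_integral (f z + cnj (f 0)) - (f 0 + cnj (f 0)) * (1 / 2)) {0..1}"
    by (intro has_integral_diff has_integral_add has_integral_mult_left I0 I1 I2 I3)
  have val: "f z + cnj (f 0) - (f 0 + cnj (f 0)) * (1 / 2) = f z - \<i> * of_real (Im (f 0))"
    by (simp add: complex_eq_iff)
  have ker: "f (circle_pt t) * (circle_pt t / (circle_pt t - z))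
        + cnj (f (circle_pt t)) * (circle_pt t / (circle_pt t - z))
        - (f (circle_pt t) + cnj (f (circle_pt t))) * (1 / 2)
      = of_real (Re (f (circle_pt t))) * ((circle_pt t + z) / (circle_pt t - z))" for t
  proof -
    have "f (circle_pt t) + cnj (f (circle_pt t)) = 2 * of_real (Re (f (circle_pt t)))"
      by (simp add: complex_add_cnj)
    moreover have "(circle_pt t + z) / (circle_pt t - z) = 2 * (circle_pt t / (circle_pt t - z)) - 1"
      using circle_pt_ne_inside[OF z, of t] by (simp add: field_simps)
    ultimately show ?thesis by (simp only: distrib_right[symmetric]) (simp add: algebra_simps)
  qed
  show ?thesis using sum unfolding val ker .
qed

text \<open>The Schwarz formula for \<open>z \<mapsto> f(r z)\<close> with \<open>r < 1\<close> represents \<open>f(r z)\<close> by a probability measure with density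
\<open>Re f(r e) / Re f(0)\<close> on the circle. These measures are tight, and a weak limit along \<open>r \<rightarrow> 1\<close>
represents \<open>f\<close> because the kernel is bounded and continuous on the circle for fixed \<open>z\<close>.\<close>

theorem Herglotz_representation:
  assumes hol: "f holomorphic_on ball 0 1" and pos: "\<And>z. cmod z < 1 \<Longrightarrow> 0 < Re (f z)"
  obtains M where "real_distribution M"
    "\<And>z. cmod z < 1 \<Longrightarrow> f z = \<i> * of_real (Im (f 0)) +
        of_real (Re (f 0)) * (\<integral>t. (circle_pt t + z) / (circle_pt t - z) \<partial>M)"
proof -
  define r where "r n = 1 - 1 / (real n + 2)" for n
  have r: "0 < r n" "r n < 1" for n by (auto simp: r_def field_simps)
  have r1: "r \<longlonglongrightarrow> 1" unfolding r_def by real_asymp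
  define c where "c = Re (f 0)"
  have c: "0 < c" using pos[of 0] by (simp add: c_def)
  have rad: "cmod (of_real (r n) * z) < 1" if "cmod z \<le> 1" for n z
  proof -
    have "cmod (of_real (r n) * z) = r n * cmod z" using r[of n] by (simp add: norm_mult)
    also have "\<dots> \<le> r n" using r[of n] that by (simp add: mult_left_le)
    finally show ?thesis using r[of n] by linarith
  qed
  have hol_r: "(\<lambda>z. f (of_real (r n) * z)) holomorphic_on cball 0 1" for n
    by (rule holomorphic_on_compose_gen[OF _ hol, unfolded o_def])
      (auto intro!: holomorphic_intros rad)
  have cont_r: "continuous_on (cball 0 1) (\<lambda>z. f (of_real (r n) * z))" for n
    by (rule holomorphic_on_imp_continuous_on[OF hol_r])
  define u where "u n t = Re (f (of_real (r n) * circle_pt t)) / c" for n t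
  have u_pos: "0 \<le> u n t" for n t
    using pos[OF rad[of "circle_pt t" n]] c by (simp add: u_def)
  have u_cont: "continuous_on UNIV (u n)" for n
    unfolding u_def
    by (intro continuous_intros continuous_on_compose2[OF cont_r] c[THEN less_imp_neq, symmetric] ballI) auto
  have u_meas [measurable]: "u n \<in> borel_measurable borel" for n
    by (rule borel_measurable_continuous_onI[OF u_cont])
  have schwarz: "((\<lambda>t. of_real (u n t) * ((circle_pt t + z) / (circle_pt t - z)))
      has_integral (f (of_real (r n) * z) - \<i> * of_real (Im (f 0))) / of_real c) {0..1}"
    if z: "cmod z < 1" for n z
  proof -
    have "((\<lambda>t. of_real (Re (f (of_real (r n) * circle_pt t))) * ((circle_pt t + z) / (circle_pt t - z)) / of_real c)
      has_integral (f (of_real (r n) * z) - \<i> * of_real (Im (f (of_real (r n) * 0)))) / of_real c) {0..1}"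
      by (intro has_integral_divide Schwarz_integral_formula cont_r z
          holomorphic_on_subset[OF hol_r]) auto
    moreover have "of_real (Re (f (of_real (r n) * circle_pt t))) * K / of_real c = of_real (u n t) * K"
      for t and K :: complex
      by (simp add: u_def)
    ultimately show ?thesis by (simp only: mult_zero_right)
  qed
  have u_int: "((u n) has_integral 1) {0..1}" for n
  proof -
    have "((\<lambda>t. of_real (u n t)) has_integral (f 0 - \<i> * of_real (Im (f 0))) / of_real c) {0..1}"
      using schwarz[of 0 n] by simp
    also have "f 0 - \<i> * of_real (Im (f 0)) = of_real c"
      by (simp add: c_def complex_eq_iff)
    finally have "((\<lambda>t. complex_of_real (u n t)) has_integral 1) {0..1}" using c by simp
    from has_integral_Re[OF this] show ?thesis by simp
  qed
  define m where "m n = density lborel (\<lambda>t. ennreal (u n t * indicator {0..1} t))" for n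
  have sets_m [measurable_cong, simp]: "sets (m n) = sets borel" for n by (simp add: m_def)
  have mass: "emeasure (m n) A = 1" if "{0..1} \<subseteq> A" "A \<in> sets borel" for n A
  proof -
    have "emeasure (m n) A = (\<integral>\<^sup>+t. ennreal (u n t * indicator {0..1} t) * indicator A t \<partial>lborel)"
      unfolding m_def using that by (intro emeasure_density) auto
    also have "\<dots> = (\<integral>\<^sup>+t. ennreal (u n t) * indicator {0..1} t \<partial>lborel)"
      using that by (intro nn_integral_cong) (auto split: split_indicator)
    also have "\<dots> = ennreal 1"
      by (rule nn_integral_has_integral_lebesgue'[OF u_pos u_int])
    finally show ?thesis by simp
  qed
  have rd: "real_distribution (m n)" for n
  proof -
    have "prob_space (m n)"
      by (rule prob_spaceI) (use mass[of UNIV n] in \<open>simp add: m_def\<close>)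
    then show ?thesis by (simp add: real_distribution_def real_distribution_axioms_def)
  qed
  have "tight m"
    unfolding tight_def
  proof (intro conjI allI impI rd)
    fix \<epsilon> :: real assume "0 < \<epsilon>"
    then have "1 - \<epsilon> < measure (m n) {-1<..1}" for n
      using mass[of "{-1<..1}" n] by (simp add: measure_def subset_iff)
    then show "\<exists>a b. a < b \<and> (\<forall>n. 1 - \<epsilon> < measure (m n) {a<..b})"
      by (intro exI[of _ "-1"] exI[of _ 1]) auto
  qed
  then obtain k M where k: "strict_mono (k :: nat \<Rightarrow> nat)" and M: "real_distribution M"
    and conv: "weak_conv_m (m \<circ> id \<circ> k) M"
    using tight_imp_convergent_subsubsequence[of m id] by (auto simp: strict_mono_id)
  have main: "f z = \<i> * of_real (Im (f 0)) + of_real c * (\<integral>t. (circle_pt t + z) / (circle_pt t - z) \<partial>M)"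
    if z: "cmod z < 1" for z
  proof -
    let ?K = "\<lambda>t. (circle_pt t + z) / (circle_pt t - z)"
    have K_cont: "continuous_on UNIV ?K"
      using circle_pt_ne_inside[OF z] by (intro continuous_intros) auto
    have K_bdd: "cmod (?K t) \<le> 2 / (1 - cmod z)" for t
    proof -
      have "cmod (circle_pt t + z) \<le> 2"
        using norm_triangle_ineq[of "circle_pt t" z] z by simp
      moreover have "1 - cmod z \<le> cmod (circle_pt t - z)"
        using norm_triangle_ineq2[of "circle_pt t" z] by simp
      ultimately show ?thesis using z by (auto simp: norm_divide intro!: frac_le)
    qed
    have int_m: "(\<integral>t. ?K t \<partial>m n) = (f (of_real (r n) * z) - \<i> * of_real (Im (f 0))) / of_real c" for n
    proof -
      have "(\<integral>t. ?K t \<partial>m n) = (\<integral>t. (u n t * indicator {0..1} t) *\<^sub>R ?K t \<partial>lborel)"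
        unfolding m_def
        by (intro integral_density) (auto intro!: borel_measurable_continuous_onI[OF K_cont] simp: u_pos)
      also have "\<dots> = (LINT t:{0..1}|lborel. of_real (u n t) * ?K t)"
        unfolding set_lebesgue_integral_def
        by (intro Bochner_Integration.integral_cong) (auto simp: scaleR_conv_of_real split: split_indicator)
      also have "\<dots> = integral {0..1} (\<lambda>t. of_real (u n t) * ?K t)"
      proof (rule set_borel_integral_eq_integral)
        show "set_integrable lborel {0..1} (\<lambda>t. of_real (u n t) * ?K t)"
          by (intro borel_integrable_atLeastAtMost' continuous_intros continuous_on_subset[OF u_cont]
              continuous_on_subset[OF K_cont]) auto
      qed
      also have "\<dots> = (f (of_real (r n) * z) - \<i> * of_real (Im (f 0))) / of_real c"
        by (rule integral_unique[OF schwarz[OF z]])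
      finally show ?thesis .
    qed
    have K_isCont: "isCont ?K t" for t
      using K_cont by (simp only: continuous_on_eq_continuous_at[OF open_UNIV] UNIV_I simp_thms ball_simps)
    have rd': "real_distribution ((m \<circ> id \<circ> k) n)" for n
      by (simp only: o_apply rd)
    have "(\<lambda>n. \<integral>t. ?K t \<partial>(m \<circ> id \<circ> k) n) \<longlonglongrightarrow> (\<integral>t. ?K t \<partial>M)"
      by (rule weak_conv_imp_integral_bdd_continuous_conv[OF rd' M conv K_isCont K_bdd])
    then have L1: "(\<lambda>n. (f (of_real (r (k n)) * z) - \<i> * of_real (Im (f 0))) / of_real c)
        \<longlonglongrightarrow> (\<integral>t. ?K t \<partial>M)" by (simp only: int_m o_apply id_apply)
    have "isCont f z"
      using holomorphic_on_imp_continuous_on[OF hol] z by (simp add: continuous_on_eq_continuous_at)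
    moreover have "(\<lambda>n. of_real (r (k n)) * z) \<longlonglongrightarrow> of_real 1 * z"
      using LIMSEQ_subseq_LIMSEQ[OF r1 k] by (intro tendsto_mult tendsto_of_real tendsto_const) (simp only: o_def)
    ultimately have L0: "(\<lambda>n. f (of_real (r (k n)) * z)) \<longlonglongrightarrow> f z"
      using isCont_tendsto_compose[of z f] by simp
    have L2: "(\<lambda>n. (f (of_real (r (k n)) * z) - \<i> * of_real (Im (f 0))) / of_real c)
        \<longlonglongrightarrow> (f z - \<i> * of_real (Im (f 0))) / of_real c"
      using c by (intro tendsto_divide tendsto_diff L0 tendsto_const) simp
    have solve: "a = b + d * e" if "e = (a - b) / d" "d \<noteq> 0" for a b d e :: complex
      using that by simp
    show ?thesis by (rule solve[OF LIMSEQ_unique[OF L1 L2]]) (use c in simp)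
  qed
  show ?thesis by (rule that[OF M main[unfolded c_def]])
qed

text \<open>Under the Cayley transform the Herglotz kernel becomes the Levy kernel, with the sign reversed.\<close>

lemma cayley_kernel:
  assumes "w \<noteq> 1" "z + \<i> \<noteq> 0" "s = \<i> * (1 + w) / (1 - w)"
  shows "\<i> * ((w + (z - \<i>) / (z + \<i>)) / (w - (z - \<i>) / (z + \<i>))) = - ((1 + s * z) / (z - s))"
proof -
  let ?A = "w * (z + \<i>) - (z - \<i>)" and ?B = "w * (z + \<i>) + (z - \<i>)"
  have w1: "1 - w \<noteq> 0" using assms(1) by simp
  have "w + (z - \<i>) / (z + \<i>) = ?B / (z + \<i>)" "w - (z - \<i>) / (z + \<i>) = ?A / (z + \<i>)"
    using assms(2) by (simp_all add: add_divide_distrib diff_divide_distrib)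
  then have 1: "(w + (z - \<i>) / (z + \<i>)) / (w - (z - \<i>) / (z + \<i>)) = ?B / ?A"
    using assms(2) by simp
  have sw: "s * (1 - w) = \<i> * (1 + w)" using w1 assms(3) by simp
  have "(1 + s * z) / (z - s) = ((1 + s * z) * (1 - w)) / ((z - s) * (1 - w))"
    using w1 by simp
  also have "(1 + s * z) * (1 - w) = (1 - w) + s * (1 - w) * z" by (simp add: algebra_simps)
  also have "(1 - w) + s * (1 - w) * z = \<i> * ?B" unfolding sw by (simp add: algebra_simps)
  also have "(z - s) * (1 - w) = z * (1 - w) - s * (1 - w)" by (simp add: algebra_simps)
  also have "z * (1 - w) - s * (1 - w) = - ?A" unfolding sw by (simp add: algebra_simps)
  finally show ?thesis unfolding 1 by (simp only: divide_minus_right minus_minus times_divide_eq_right)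
qed

lemma cayley_circle_pt_real:
  assumes "circle_pt t \<noteq> 1"
  shows "\<i> * (1 + circle_pt t) / (1 - circle_pt t) =
    of_real (Re (\<i> * (1 + circle_pt t) / (1 - circle_pt t)))" (is "?s = of_real (Re ?s)")
proof -
  have "cnj ?s = ?s"
    using assms by (simp add: cnj_circle_pt divide_simps) (simp add: algebra_simps)
  then have "?s \<in> \<real>" by (simp only: Reals_cnj_iff)
  then show ?thesis by (simp only: of_real_Re)
qed

text \<open>Herglotz's theorem is transported from the disc by the Cayley transform \<open>z = \<i>(1 + w)/(1 - w)\<close>. The mass of
the representing measure at the point 1 of the circle, which corresponds to infinity, gives
the linear term; the remaining mass is pushed forward to the real line.\<close>

theorem Nevanlinna_representation:
  assumes hol: "N holomorphic_on upper_half_plane" and pos: "\<And>z. 0 < Im z \<Longrightarrow> 0 < Im (N z)"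
  obtains a b :: real and \<rho> where "finite_borel_measure \<rho>" "0 \<le> b"
    "\<And>z. 0 < Im z \<Longrightarrow> N z = of_real a + of_real b * z - levy_integral \<rho> z"
proof -
  define f where "f w = - \<i> * N (\<i> * (1 + w) / (1 - w))" for w
  have cay_Im: "0 < Im (\<i> * (1 + w) / (1 - w))" if "cmod w < 1" for w
  proof -
    have "w \<noteq> 1" using that by auto
    moreover have "(Re w)\<^sup>2 + (Im w)\<^sup>2 < 1"
      using that by (metis abs_norm_cancel abs_square_less_1 cmod_power2)
    moreover have "Im (\<i> * (1 + w) * cnj (1 - w)) = 1 - ((Re w)\<^sup>2 + (Im w)\<^sup>2)"
      by (simp add: power2_eq_square algebra_simps)
    ultimately show ?thesis
      by (subst complex_div_cnj) (simp only: Im_divide_of_real, simp)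
  qed
  have hol_f: "f holomorphic_on ball 0 1"
    unfolding f_def using cay_Im
    by (intro holomorphic_intros holomorphic_on_compose_gen[OF _ hol, unfolded o_def]) auto
  have pos_f: "0 < Re (f w)" if "cmod w < 1" for w
    using pos[OF cay_Im[OF that]] by (simp add: f_def)
  obtain M where M: "real_distribution M" and rep: "\<And>w. cmod w < 1 \<Longrightarrow>
      f w = \<i> * of_real (Im (f 0)) +
        of_real (Re (f 0)) * (\<integral>t. (circle_pt t + w) / (circle_pt t - w) \<partial>M)"
    by (rule Herglotz_representation[OF hol_f]) (rule pos_f, assumption, rule that, assumption, iprover)
  interpret M: real_distribution M by fact
  define C where "C = Re (f 0)"
  have C: "0 < C" using pos[OF cay_Im[of 0]] by (simp add: f_def C_def)
  define S where "S = {t. circle_pt t \<noteq> 1}"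
  have circle_meas [measurable]: "circle_pt \<in> borel_measurable borel"
    by (rule borel_measurable_continuous_onI) (rule continuous_on_circle_pt)
  have S [measurable]: "S \<in> sets borel" unfolding S_def by measurable
  define s where "s t = Re (\<i> * (1 + circle_pt t) / (1 - circle_pt t))" for t
  have s_meas [measurable]: "s \<in> borel_measurable borel" unfolding s_def by measurable
  define M' where "M' = density M (\<lambda>t. ennreal (C * indicator S t))"
  define \<rho> where "\<rho> = distr M' borel s"
  have M'_sets [measurable_cong]: "sets M' = sets borel" by (simp add: M'_def)
  have "emeasure M' (space M') \<le> ennreal C"
  proof -
    have "emeasure M' (space M') = (\<integral>\<^sup>+t. ennreal (C * indicator S t) \<partial>M)"
      unfolding M'_def by (subst emeasure_density) (auto intro!: nn_integral_cong)
    also have "\<dots> \<le> (\<integral>\<^sup>+t. ennreal C \<partial>M)"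
      using C by (intro nn_integral_mono) (auto split: split_indicator)
    finally show ?thesis by (simp add: M.emeasure_space_1[simplified])
  qed
  then have "emeasure M' (space M') \<noteq> \<infinity>" by (auto simp: top_unique)
  then have "finite_measure M'" by (rule finite_measureI)
  then have "finite_measure \<rho>"
    unfolding \<rho>_def by (rule finite_measure.finite_measure_distr) measurable
  then have rho: "finite_borel_measure \<rho>"
    by (simp add: finite_borel_measure_def finite_borel_measure_axioms_def \<rho>_def)
  interpret R: finite_borel_measure \<rho> by fact
  define b where "b = C * measure M (- S)"
  have b: "0 \<le> b" using C by (simp add: b_def)
  have main: "N z = of_real (- Im (f 0)) + of_real b * z - levy_integral \<rho> z" if z: "0 < Im z" for z
  proof -
    let ?w = "(z - \<i>) / (z + \<i>)"
    have zi: "z + \<i> \<noteq> 0" using z by (auto simp: complex_eq_iff)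
    have w: "cmod ?w < 1"
    proof -
      have "(cmod (z - \<i>))\<^sup>2 < (cmod (z + \<i>))\<^sup>2"
        unfolding cmod_power2 using z by (simp add: power2_eq_square algebra_simps)
      then have "cmod (z - \<i>) < cmod (z + \<i>)" by (rule power_less_imp_less_base) simp
      then show ?thesis using zi by (simp add: norm_divide)
    qed
    have cay: "\<i> * (1 + ?w) / (1 - ?w) = z"
      using zi by (simp add: divide_simps)
    let ?K = "\<lambda>t. \<i> * ((circle_pt t + ?w) / (circle_pt t - ?w))"
    have K_one: "?K t = z" if "t \<notin> S" for t
      using that cay unfolding S_def by simp
    have K_S: "?K t = - ((1 + of_real (s t) * z) / (z - of_real (s t)))" if "t \<in> S" for t
      using that cayley_kernel[OF _ zi, of "circle_pt t" "of_real (s t)"]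
        cayley_circle_pt_real[of t] unfolding S_def s_def by simp
    have levy: "levy_integral \<rho> z =
        (\<integral>t. (C * indicator S t) *\<^sub>R ((1 + of_real (s t) * z) / (z - of_real (s t))) \<partial>M)"
      unfolding levy_integral_def \<rho>_def M'_def using C
      by (subst integral_distr) (auto intro!: integral_density simp: measurable_density_eq1)
    have int1: "integrable M (\<lambda>t. (C * indicator S t) *\<^sub>R ((1 + of_real (s t) * z) / (z - of_real (s t))))"
    proof -
      have "integrable \<rho> (\<lambda>s. (1 + of_real s * z) / (z - of_real s))"
        by (rule R.integrable_levy_kernel[OF z])
      then have "integrable M' (\<lambda>t. (1 + of_real (s t) * z) / (z - of_real (s t)))"
        unfolding \<rho>_def by (subst (asm) integrable_distr_eq) auto
      then show ?thesis
        unfolding M'_def using C by (subst (asm) integrable_density) auto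
    qed
    have int2: "integrable M (\<lambda>t. (C * indicator (- S) t) *\<^sub>R z)"
      by (intro integrable_scaleR_left integrable_mult_right integrable_real_indicator)
        (auto simp: M.emeasure_eq_measure)
    have "N z = \<i> * f ?w" by (simp only: f_def cay) simp
    also have "\<dots> = of_real (- Im (f 0)) + of_real C * (\<integral>t. ?K t \<partial>M)"
    proof -
      have "\<i> * (\<i> * of_real A + of_real C * I) = of_real (- A) + of_real C * (\<i> * I)" for A I
        by (simp add: algebra_simps)
      then show ?thesis
        unfolding rep[OF w] C_def[symmetric] by (simp only: integral_mult_right_zero)
    qed
    also have "of_real C * (\<integral>t. ?K t \<partial>M) = (\<integral>t. of_real C * ?K t \<partial>M)"
      by (rule integral_mult_right_zero[symmetric])
    also have "\<dots> = (\<integral>t. (C * indicator (- S) t) *\<^sub>R z -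
        (C * indicator S t) *\<^sub>R ((1 + of_real (s t) * z) / (z - of_real (s t))) \<partial>M)"
    proof (rule Bochner_Integration.integral_cong[OF refl])
      fix t
      show "of_real C * ?K t = (C * indicator (- S) t) *\<^sub>R z -
        (C * indicator S t) *\<^sub>R ((1 + of_real (s t) * z) / (z - of_real (s t)))"
      proof (cases "t \<in> S")
        case True
        then show ?thesis unfolding K_S[OF True] by (simp add: scaleR_conv_of_real)
      next
        case False
        then show ?thesis unfolding K_one[OF False] by (simp add: scaleR_conv_of_real)
      qed
    qed
    also have "\<dots> = of_real b * z - levy_integral \<rho> z"
      unfolding levy Bochner_Integration.integral_diff[OF int2 int1]
      by (simp add: b_def scaleR_conv_of_real)
    finally show ?thesis by simp
  qed
  show ?thesis by (rule that[OF rho b main])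
qed

section \<open>The reciprocal Cauchy transform\<close>

definition resolvent_sq_int :: "real measure \<Rightarrow> complex \<Rightarrow> real" where
  "resolvent_sq_int M z = (\<integral>s. 1 / (cmod (z - of_real s))\<^sup>2 \<partial>M)"

lemma (in finite_borel_measure) integrable_resolvent_sq:
  assumes "0 < Im z"
  shows "integrable M (\<lambda>s. 1 / (cmod (z - of_real s))\<^sup>2)"
proof -
  have "integrable M (\<lambda>s. - Im (1 / (z - of_real s)) / Im z)"
    using integrable_cauchy_kernel[OF assms]
    by (intro integrable_divide integrable_minus integrable_Im)
  then show ?thesis using assms unfolding Im_inverse_diff_real by simp
qed

lemma (in finite_borel_measure) Im_cauchy_transform:
  assumes "0 < Im z"
  shows "Im (cauchy_transform M z) = - Im z * resolvent_sq_int M z"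
proof -
  have "Im (cauchy_transform M z) = (\<integral>s. Im (1 / (z - of_real s)) \<partial>M)"
    unfolding cauchy_transform_def by (rule integral_Im[OF integrable_cauchy_kernel[OF assms], symmetric])
  also have "\<dots> = (\<integral>s. - Im z * (1 / (cmod (z - of_real s))\<^sup>2) \<partial>M)"
    unfolding Im_inverse_diff_real by simp
  finally show ?thesis unfolding resolvent_sq_int_def by (simp only: integral_mult_right_zero)
qed

context real_distribution
begin

lemma distribution_not_null: "M \<noteq> null_measure borel"
  using emeasure_space_1 by auto

lemma resolvent_sq_int_pos:
  assumes "0 < Im z"
  shows "0 < resolvent_sq_int M z"
proof -
  have "(\<integral>s. 0 \<partial>M) < (\<integral>s. 1 / (cmod (z - of_real s))\<^sup>2 \<partial>M)"
    using upper_ne_real[OF assms]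
    by (intro integral_less_AE_space integrable_resolvent_sq assms emeasure_space_nonzero distribution_not_null) auto
  then show ?thesis by (simp add: resolvent_sq_int_def)
qed

lemma Im_cauchy_transform_neg: "0 < Im z \<Longrightarrow> Im (cauchy_transform M z) < 0"
  by (simp add: Im_cauchy_transform resolvent_sq_int_pos)

lemma cauchy_transform_nonzero: "0 < Im z \<Longrightarrow> cauchy_transform M z \<noteq> 0"
  using Im_cauchy_transform_neg[of z] by auto

text \<open>The Cauchy-Schwarz inequality, in the form that the variance of \<open>1 / |z - s|\<close> is nonnegative.\<close>

lemma cmod_cauchy_transform_sq_le:
  assumes z: "0 < Im z"
  shows "(cmod (cauchy_transform M z))\<^sup>2 \<le> resolvent_sq_int M z"
proof -
  let ?X = "\<lambda>s. 1 / cmod (z - of_real s)"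
  have X: "integrable M ?X"
    using integrable_norm[OF integrable_cauchy_kernel[OF z]] by (simp add: norm_divide)
  have X2: "integrable M (\<lambda>s. (?X s)\<^sup>2)"
    using integrable_resolvent_sq[OF z] by (simp add: power_divide)
  have "cmod (cauchy_transform M z) \<le> expectation ?X"
    unfolding cauchy_transform_def
    using integral_norm_bound[of M "\<lambda>s. 1 / (z - of_real s)"] by (simp add: norm_divide)
  then have "(cmod (cauchy_transform M z))\<^sup>2 \<le> (expectation ?X)\<^sup>2"
    by (intro power_mono) auto
  also have "\<dots> \<le> expectation (\<lambda>s. (?X s)\<^sup>2)"
    using variance_eq[OF X X2] variance_positive[of ?X] by linarith
  finally show ?thesis by (simp add: resolvent_sq_int_def power_divide)
qed

text \<open>Besides giving \<open>Im F(z) \<ge> Im z\<close>, this exact formula controls \<open>Im F / Im z\<close> from below by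
\<open>|F|\<^sup>2\<close> where \<open>F\<close> is large.\<close>

lemma Im_recip_cauchy:
  assumes z: "0 < Im z"
  shows "Im (recip_cauchy M z) = Im z * (resolvent_sq_int M z * (cmod (recip_cauchy M z))\<^sup>2)"
proof -
  have "Im (recip_cauchy M z) = - Im (cauchy_transform M z) / (cmod (cauchy_transform M z))\<^sup>2"
    by (simp add: recip_cauchy_def Im_divide cmod_power2)
  then show ?thesis
    by (simp add: Im_cauchy_transform[OF z] recip_cauchy_def norm_divide power_divide)
qed

lemma Im_recip_cauchy_ge:
  assumes z: "0 < Im z"
  shows "Im z \<le> Im (recip_cauchy M z)"
proof -
  have "0 < (cmod (cauchy_transform M z))\<^sup>2" using cauchy_transform_nonzero[OF z] by simp
  then have "1 \<le> resolvent_sq_int M z * (cmod (recip_cauchy M z))\<^sup>2"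
    using cmod_cauchy_transform_sq_le[OF z]
    by (simp add: recip_cauchy_def norm_divide power_divide)
  then show ?thesis unfolding Im_recip_cauchy[OF z] using z by simp
qed

lemma Im_recip_cauchy_pos: "0 < Im z \<Longrightarrow> 0 < Im (recip_cauchy M z)"
  using Im_recip_cauchy_ge[of z] by simp

lemma recip_cauchy_holomorphic: "recip_cauchy M holomorphic_on upper_half_plane"
  unfolding recip_cauchy_def
  by (intro holomorphic_intros cauchy_transform_holomorphic) (simp add: cauchy_transform_nonzero)

text \<open>A quantitative remnant of \<open>F(iy) \<sim> iy\<close>: since \<open>- y Im G(iy)\<close> tends to 1, eventually \<open>y |G(iy)| \<ge> 1/2\<close>.\<close>

lemma eventually_cmod_recip_cauchy_le:
  "\<forall>\<^sub>F y in at_top. cmod (recip_cauchy M (Complex 0 y)) \<le> 2 * y"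
proof -
  have "((\<lambda>y. \<integral>s. y\<^sup>2 / (s\<^sup>2 + y\<^sup>2) \<partial>M) \<longlongrightarrow> (\<integral>s. 1 \<partial>M)) at_top"
  proof (rule integral_dominated_convergence_at_top)
    show "\<forall>\<^sub>F y in at_top. AE s in M. norm (y\<^sup>2 / (s\<^sup>2 + y\<^sup>2)) \<le> 1"
    proof (intro always_eventually allI AE_I2)
      fix y s :: real
      have "y\<^sup>2 / (s\<^sup>2 + y\<^sup>2) \<le> (s\<^sup>2 + y\<^sup>2) / (s\<^sup>2 + y\<^sup>2)"
        by (intro divide_right_mono) auto
      also have "\<dots> \<le> 1" by (simp add: divide_self_if)
      finally show "norm (y\<^sup>2 / (s\<^sup>2 + y\<^sup>2)) \<le> 1" by (simp add: abs_of_nonneg)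
    qed
    have "((\<lambda>y. y\<^sup>2 / (s\<^sup>2 + y\<^sup>2)) \<longlongrightarrow> 1) at_top" for s :: real by real_asymp
    then show "AE s in M. ((\<lambda>y. y\<^sup>2 / (s\<^sup>2 + y\<^sup>2)) \<longlongrightarrow> 1) at_top" by simp
  qed auto
  then have "\<forall>\<^sub>F y in at_top. 1 / 2 < (\<integral>s. y\<^sup>2 / (s\<^sup>2 + y\<^sup>2) \<partial>M)"
    by (rule order_tendstoD(1)) (use prob_space in simp)
  then show ?thesis
    using eventually_gt_at_top[of 0]
  proof eventually_elim
    fix y :: real assume half: "1 / 2 < (\<integral>s. y\<^sup>2 / (s\<^sup>2 + y\<^sup>2) \<partial>M)" and y: "0 < y"
    let ?G = "cauchy_transform M (Complex 0 y)"
    have "(\<integral>s. y\<^sup>2 / (s\<^sup>2 + y\<^sup>2) \<partial>M) = y\<^sup>2 * resolvent_sq_int M (Complex 0 y)"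
      unfolding resolvent_sq_int_def
      by (simp add: cmod_diff_real_sq flip: integral_mult_right_zero)
    also have "\<dots> = y * (- Im ?G)"
      using y by (simp add: Im_cauchy_transform power2_eq_square)
    also have "\<dots> \<le> y * cmod ?G"
      using y abs_Im_le_cmod[of ?G] by (intro mult_left_mono) auto
    finally have "1 \<le> 2 * y * cmod ?G" using half by simp
    moreover have "0 < cmod ?G" using cauchy_transform_nonzero[of "Complex 0 y"] y by simp
    ultimately show "cmod (recip_cauchy M (Complex 0 y)) \<le> 2 * y"
      by (simp add: recip_cauchy_def norm_divide divide_le_eq)
  qed
qed

end

section \<open>The measure representing the subordination map\<close>

locale levy_and_distribution = L: finite_borel_measure \<sigma> + D: real_distribution \<nu>
  for \<sigma> \<nu> :: "real measure" +
  fixes \<gamma> :: real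
  assumes levy_nonzero: "\<sigma> \<noteq> null_measure borel"
begin

abbreviation F :: "complex \<Rightarrow> complex" where "F \<equiv> recip_cauchy \<nu>"
abbreviation \<phi> :: "complex \<Rightarrow> complex" where "\<phi> \<equiv> free_levy_phi \<gamma> \<sigma>"

lemma Im_phi_F: "0 < Im z \<Longrightarrow> Im (\<phi> (F z)) = - Im (F z) * poisson_int \<sigma> (F z)"
  by (simp add: L.Im_free_levy_phi D.Im_recip_cauchy_pos)

lemma poisson_int_F_pos: "0 < Im z \<Longrightarrow> 0 < poisson_int \<sigma> (F z)"
  by (simp add: L.poisson_int_pos levy_nonzero D.Im_recip_cauchy_pos)

lemma phi_F_holomorphic: "(\<lambda>z. \<phi> (F z)) holomorphic_on upper_half_plane"
proof -
  have "\<phi> holomorphic_on upper_half_plane"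
    unfolding free_levy_phi_def by (intro holomorphic_intros L.levy_integral_holomorphic)
  from holomorphic_on_compose_gen[OF D.recip_cauchy_holomorphic this]
  show ?thesis by (simp add: o_def image_subset_iff D.Im_recip_cauchy_pos)
qed

text \<open>Dominated convergence. As \<open>|F(iy)| \<le> 2y\<close> and \<open>|F(iy) - s| \<ge> Im F(iy) \<ge> y\<close>, one has
\<open>|s| \<le> 3 |F(iy) - s|\<close>, so the kernel is bounded by a constant, and it is at most \<open>(1 + s\<^sup>2) / y\<^sup>2\<close>.\<close>

lemma poisson_int_F_tendsto_0: "((\<lambda>y. poisson_int \<sigma> (F (Complex 0 y))) \<longlongrightarrow> 0) at_top"
proof -
  have ev: "\<forall>\<^sub>F y in at_top. \<forall>s. s\<^sup>2 \<le> 10 * (cmod (F (Complex 0 y) - of_real s))\<^sup>2 \<and>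
      y \<le> cmod (F (Complex 0 y) - of_real s)"
    using D.eventually_cmod_recip_cauchy_le eventually_gt_at_top[of 0]
  proof (eventually_elim, intro allI)
    fix y s :: real assume le: "cmod (F (Complex 0 y)) \<le> 2 * y" and y: "0 < y"
    let ?d = "cmod (F (Complex 0 y) - of_real s)"
    have "y \<le> Im (F (Complex 0 y))" using D.Im_recip_cauchy_ge[of "Complex 0 y"] y by simp
    also have "\<dots> \<le> ?d" by (rule Im_le_cmod_diff_real)
    finally have yd: "y \<le> ?d" .
    have "\<bar>s\<bar> \<le> ?d + cmod (F (Complex 0 y))"
      using norm_triangle_ineq4[of "F (Complex 0 y)" "F (Complex 0 y) - of_real s"] by simp
    then have "\<bar>s\<bar> \<le> 3 * ?d" using le yd by linarith
    then have "\<bar>s\<bar>\<^sup>2 \<le> (3 * ?d)\<^sup>2" by (intro power_mono) auto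
    then have "s\<^sup>2 \<le> 9 * ?d\<^sup>2" by (simp add: power_mult_distrib)
    then have "s\<^sup>2 \<le> 10 * ?d\<^sup>2" using zero_le_power2[of ?d] by linarith
    with yd show "s\<^sup>2 \<le> 10 * ?d\<^sup>2 \<and> y \<le> ?d" by simp
  qed
  have "((\<lambda>y. \<integral>s. poisson_kernel (F (Complex 0 y)) s \<partial>\<sigma>) \<longlongrightarrow> (\<integral>s. 0 \<partial>\<sigma>)) at_top"
  proof (rule integral_dominated_convergence_at_top)
    show "\<forall>\<^sub>F y in at_top. AE s in \<sigma>. norm (poisson_kernel (F (Complex 0 y)) s) \<le> 11"
      using ev eventually_ge_at_top[of 1]
    proof (eventually_elim, intro AE_I2)
      fix y s :: real
      assume *: "\<forall>s. s\<^sup>2 \<le> 10 * (cmod (F (Complex 0 y) - of_real s))\<^sup>2 \<and> y \<le> cmod (F (Complex 0 y) - of_real s)"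
        and y: "1 \<le> y"
      let ?d = "cmod (F (Complex 0 y) - of_real s)"
      have d: "1 \<le> ?d" using * y order_trans by blast
      then have "1 \<le> ?d\<^sup>2" by simp
      then have "1 + s\<^sup>2 \<le> 11 * ?d\<^sup>2" using *[rule_format, of s] by linarith
      then show "norm (poisson_kernel (F (Complex 0 y)) s) \<le> 11"
        using \<open>1 \<le> ?d\<^sup>2\<close> by (simp add: poisson_kernel_def divide_le_eq)
    qed
    show "AE s in \<sigma>. ((\<lambda>y. poisson_kernel (F (Complex 0 y)) s) \<longlongrightarrow> 0) at_top"
    proof (rule AE_I2, rule Lim_null_comparison)
      fix s :: real
      show "((\<lambda>y. (1 + s\<^sup>2) / y\<^sup>2) \<longlongrightarrow> 0) at_top" by real_asymp
      show "\<forall>\<^sub>F y in at_top. norm (poisson_kernel (F (Complex 0 y)) s) \<le> (1 + s\<^sup>2) / y\<^sup>2"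
        using ev eventually_gt_at_top[of 0]
      proof eventually_elim
        fix y :: real
        assume *: "\<forall>s. s\<^sup>2 \<le> 10 * (cmod (F (Complex 0 y) - of_real s))\<^sup>2 \<and> y \<le> cmod (F (Complex 0 y) - of_real s)"
          and y: "0 < y"
        have "y\<^sup>2 \<le> (cmod (F (Complex 0 y) - of_real s))\<^sup>2"
          using * y by (intro power_mono) auto
        then show "norm (poisson_kernel (F (Complex 0 y)) s) \<le> (1 + s\<^sup>2) / y\<^sup>2"
          using y by (auto simp: poisson_kernel_def intro!: divide_left_mono mult_pos_pos)
      qed
    qed
  qed auto
  then show ?thesis by (simp add: poisson_int_def)
qed

text \<open>The coefficient \<open>b\<close> of the linear term in the Nevanlinna representation of \<open>- \<phi> \<circ> F\<close> satisfies
\<open>b \<le> - Im \<phi>(F(iy)) / y \<le> 2 P\<^sub>\<sigma>(F(iy))\<close>, which tends to 0.\<close>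

lemma ex_representing_measure:
  "\<exists>\<rho>. finite_borel_measure \<rho> \<and> \<rho> \<noteq> null_measure borel \<and>
      (\<exists>a::real. \<forall>z \<in> upper_half_plane. subord_H \<phi> \<nu> z = of_real a + z + levy_integral \<rho> z)"
proof -
  have hol: "(\<lambda>z. - \<phi> (F z)) holomorphic_on upper_half_plane"
    by (intro holomorphic_intros phi_F_holomorphic)
  have pos: "0 < Im (- \<phi> (F z))" if "0 < Im z" for z
    using that by (simp add: Im_phi_F D.Im_recip_cauchy_pos poisson_int_F_pos)
  obtain a b :: real and \<rho> where rho: "finite_borel_measure \<rho>" and b: "0 \<le> b"
    and rep: "\<And>z. 0 < Im z \<Longrightarrow> - \<phi> (F z) = of_real a + of_real b * z - levy_integral \<rho> z"
    by (rule Nevanlinna_representation[OF hol]) (rule pos, assumption, rule that, assumption, assumption, iprover)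
  interpret R: finite_borel_measure \<rho> by fact
  have "b \<le> 0"
  proof (rule tendsto_lowerbound)
    show "((\<lambda>y. 2 * poisson_int \<sigma> (F (Complex 0 y))) \<longlongrightarrow> 0) at_top"
      using tendsto_mult_right_zero[OF poisson_int_F_tendsto_0, of 2] by simp
    show "\<forall>\<^sub>F y in at_top. b \<le> 2 * poisson_int \<sigma> (F (Complex 0 y))"
      using D.eventually_cmod_recip_cauchy_le eventually_gt_at_top[of 0]
    proof eventually_elim
      fix y :: real assume le: "cmod (F (Complex 0 y)) \<le> 2 * y" and y: "0 < y"
      let ?z = "Complex 0 y"
      have "b * y \<le> b * y + y * poisson_int \<rho> ?z"
        using y by (simp add: R.poisson_int_nonneg)
      also have "\<dots> = Im (of_real a + of_real b * ?z - levy_integral \<rho> ?z)"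
        using y by (simp add: R.Im_levy_integral)
      also have "\<dots> = Im (- \<phi> (F ?z))" using rep[of ?z] y by simp
      also have "\<dots> = Im (F ?z) * poisson_int \<sigma> (F ?z)" using Im_phi_F[of ?z] y by simp
      also have "\<dots> \<le> (2 * y) * poisson_int \<sigma> (F ?z)"
        using le abs_Im_le_cmod[of "F ?z"] by (intro mult_right_mono L.poisson_int_nonneg) auto
      finally show "b \<le> 2 * poisson_int \<sigma> (F ?z)" using y by simp
    qed
  qed simp
  with b have b0: "b = 0" by simp
  have H: "subord_H \<phi> \<nu> z = of_real (- a) + z + levy_integral \<rho> z" if "0 < Im z" for z
    using rep[OF that] by (simp add: subord_H_def b0 algebra_simps eq_neg_iff_add_eq_0)
  have "\<rho> \<noteq> null_measure borel"
  proof
    assume null: "\<rho> = null_measure borel"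
    have "poisson_int \<rho> \<i> = 0" by (simp add: poisson_int_def null)
    then have "Im (levy_integral \<rho> \<i>) = 0" by (simp add: R.Im_levy_integral)
    then show False using rep[of \<i>] pos[of \<i>] by (simp add: b0)
  qed
  then show ?thesis using rho H by (intro exI[of _ \<rho>] conjI exI[of _ "- a"] ballI) auto
qed

end

section \<open>Translated Levy integrals and the boundary of their domain of univalence\<close>

text \<open>The map \<open>H\<close> is studied here for an arbitrary nonzero measure \<open>\<rho>\<close>; \<open>height\<close>, \<open>curve\<close> and \<open>Omega\<close> are
\<open>f\<close>, \<open>x + i f(x)\<close> and \<open>\<Omega>\<close>, with \<open>Im H(z) > 0\<close> expressed as \<open>P z < 1\<close>.\<close>

locale levy_perturbation = finite_borel_measure \<rho> for \<rho> :: "real measure" +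
  fixes a :: real
  assumes nonzero: "\<rho> \<noteq> null_measure borel"
begin

abbreviation P :: "complex \<Rightarrow> real" where "P \<equiv> poisson_int \<rho>"

definition H :: "complex \<Rightarrow> complex" where
  "H z = of_real a + z + levy_integral \<rho> z"

definition height :: "real \<Rightarrow> real" where
  "height x = Inf {y. 0 < y \<and> P (Complex x y) < 1}"

definition curve :: "real \<Rightarrow> complex" where
  "curve x = Complex x (height x)"

definition Omega :: "complex set" where
  "Omega = {z. 0 < Im z \<and> P z < 1}"

lemma Re_curve [simp]: "Re (curve x) = x" and Im_curve [simp]: "Im (curve x) = height x"
  by (simp_all add: curve_def)

lemma ex_P_less_1: "\<exists>y>0. P (Complex x y) < 1"
proof -
  have "\<forall>\<^sub>F y in at_top. P (Complex x y) < 1 \<and> 0 < y"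
    by (intro eventually_conj order_tendstoD(2)[OF poisson_int_tendsto_0] eventually_gt_at_top) simp
  then show ?thesis by (metis (mono_tags, lifting) eventually_happens trivial_limit_at_top_linorder)
qed

lemma height_nonneg: "0 \<le> height x"
  unfolding height_def using ex_P_less_1[of x] by (intro cInf_greatest) auto

lemma height_less_iff:
  assumes "0 < y"
  shows "height x < y \<longleftrightarrow> P (Complex x y) < 1"
proof
  assume "height x < y"
  then obtain y' where y': "0 < y'" "P (Complex x y') < 1" "y' < y"
    unfolding height_def using ex_P_less_1[of x] by (subst (asm) cInf_less_iff) (auto intro!: bdd_belowI[of _ 0])
  then show "P (Complex x y) < 1"
    using poisson_int_strict_antimono[OF nonzero y'(1,3), of x] by linarith
next
  assume less: "P (Complex x y) < 1"
  have "((\<lambda>u. P (Complex x u)) \<longlongrightarrow> P (Complex x y)) (at_left y)"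
    using assms by (intro poisson_int_tendsto) (auto intro!: tendsto_Complex)
  then have "\<forall>\<^sub>F u in at_left y. P (Complex x u) < 1"
    using less by (rule order_tendstoD(2))
  moreover have "\<forall>\<^sub>F u in at_left y. 0 < u"
    using assms by (intro order_tendstoD(1)[OF tendsto_ident_at])
  moreover have "\<forall>\<^sub>F u in at_left y. u < y"
    by (simp add: eventually_at_filter)
  ultimately have "\<forall>\<^sub>F u in at_left y. P (Complex x u) < 1 \<and> 0 < u \<and> u < y"
    by eventually_elim simp
  then obtain u where u: "P (Complex x u) < 1" "0 < u" "u < y"
    by (metis (mono_tags, lifting) eventually_happens trivial_limit_at_left_real)
  then have "height x \<le> u" unfolding height_def by (intro cInf_lower) (auto intro!: bdd_belowI[of _ 0])
  with u show "height x < y" by simp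
qed

lemma height_eq_iff:
  assumes y: "0 < y"
  shows "height x = y \<longleftrightarrow> P (Complex x y) = 1"
proof
  assume h: "height x = y"
  then have "1 \<le> P (Complex x y)" using height_less_iff[OF y, of x] by auto
  moreover have "P (Complex x y) \<le> 1"
  proof (rule tendsto_upperbound)
    show "((\<lambda>u. P (Complex x u)) \<longlongrightarrow> P (Complex x y)) (at_right y)"
      using y by (intro poisson_int_tendsto) (auto intro!: tendsto_Complex)
    have "P (Complex x u) \<le> 1" if "y < u" for u
      using height_less_iff[of u x] h y that by auto
    then show "\<forall>\<^sub>F u in at_right y. P (Complex x u) \<le> 1"
      by (auto simp: eventually_at_filter)
  qed simp
  ultimately show "P (Complex x y) = 1" by simp
next
  assume P: "P (Complex x y) = 1"
  then have "y \<le> height x" using height_less_iff[OF y, of x] by auto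
  moreover have "\<not> y < height x"
  proof
    assume less: "y < height x"
    define u where "u = (y + height x) / 2"
    have u: "y < u" "u < height x" using less by (auto simp: u_def)
    have "P (Complex x u) < 1" using poisson_int_strict_antimono[OF nonzero y u(1), of x] P by simp
    with height_less_iff[of u x] u y show False by auto
  qed
  ultimately show "height x = y" by simp
qed

text \<open>The points of the closed upper half-plane at which \<open>H\<close> and the Poisson integral are given by convergent integrals.
For real \<open>z\<close> the second condition excludes an atom at \<open>z\<close>, where division by zero would
otherwise make the integrand 0.\<close>

definition extended_domain :: "complex set" where
  "extended_domain =
     {z. 0 \<le> Im z \<and> (AE s in \<rho>. z \<noteq> of_real s) \<and> integrable \<rho> (poisson_kernel z)}"

lemma upper_in_extended_domain: "0 < Im z \<Longrightarrow> z \<in> extended_domain"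
  using upper_ne_real[of z] by (simp add: extended_domain_def integrable_poisson_kernel)

lemma real_point_in_extended_domain:
  assumes "boundary_integral \<rho> x \<le> 1"
  shows "of_real x \<in> extended_domain" "P (of_real x) \<le> 1"
proof -
  have fin: "(\<integral>\<^sup>+s. ennreal (1 + s\<^sup>2) / ennreal ((x - s)\<^sup>2) \<partial>\<rho>) \<noteq> \<infinity>"
    using assms by (auto simp: boundary_integral_def top_unique)
  have "AE s in \<rho>. ennreal (1 + s\<^sup>2) / ennreal ((x - s)\<^sup>2) \<noteq> \<infinity>"
    by (rule nn_integral_PInf_AE[OF _ fin]) measurable
  then have ae: "AE s in \<rho>. x \<noteq> s"
  proof (rule AE_mp[OF _ AE_I2], intro impI notI)
    fix s assume "ennreal (1 + s\<^sup>2) / ennreal ((x - s)\<^sup>2) \<noteq> \<infinity>" "x = s"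
    then show False using one_plus_sq_pos[of s] by (simp add: ennreal_eq_0_iff del: ennreal_plus)
  qed
  have "(\<integral>\<^sup>+s. ennreal (poisson_kernel (of_real x) s) \<partial>\<rho>) =
      (\<integral>\<^sup>+s. ennreal (1 + s\<^sup>2) / ennreal ((x - s)\<^sup>2) \<partial>\<rho>)"
  proof (rule nn_integral_cong_AE, rule AE_mp[OF ae AE_I2], intro impI)
    fix s assume "x \<noteq> s"
    then show "ennreal (poisson_kernel (of_real x) s) = ennreal (1 + s\<^sup>2) / ennreal ((x - s)\<^sup>2)"
      by (simp add: poisson_kernel_def cmod_diff_real_sq divide_ennreal del: ennreal_plus)
  qed
  then have le: "(\<integral>\<^sup>+s. ennreal (poisson_kernel (of_real x) s) \<partial>\<rho>) \<le> 1"
    using assms by (simp add: boundary_integral_def)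
  have int: "integrable \<rho> (poisson_kernel (of_real x))"
    by (rule integrableI_bounded) (use le in \<open>auto simp: le_less_trans[OF _ ennreal_one_less_top]\<close>)
  then show "of_real x \<in> extended_domain" using ae by (simp add: extended_domain_def)
  have "ennreal (P (of_real x)) \<le> 1"
    unfolding poisson_int_def using le nn_integral_eq_integral[OF int] by simp
  then show "P (of_real x) \<le> 1" by simp
qed

lemma curve_in_extended_domain: "curve x \<in> extended_domain"
  and P_curve_le: "P (curve x) \<le> 1"
proof -
  have "curve x \<in> extended_domain \<and> P (curve x) \<le> 1"
  proof (cases "height x = 0")
    case True
    have "P (Complex x y) \<le> 1" if "0 < y" for y
      using height_less_iff[OF that, of x] True that by simp
    then have "boundary_integral \<rho> x \<le> 1"
      using poisson_int_le_imp_boundary_integral_le[of x 1] by simp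
    moreover have "curve x = of_real x" using True by (simp add: curve_def complex_eq_iff)
    ultimately show ?thesis using real_point_in_extended_domain by simp
  next
    case False
    then have "0 < height x" using height_nonneg[of x] by simp
    then show ?thesis using height_eq_iff[of "height x" x] upper_in_extended_domain[of "curve x"]
      by (simp add: curve_def)
  qed
  then show "curve x \<in> extended_domain" "P (curve x) \<le> 1" by auto
qed

text \<open>The deviation of the difference quotient of \<open>H\<close> from 1; on the diagonal, of its derivative.\<close>

definition Q :: "complex \<Rightarrow> complex \<Rightarrow> complex" where
  "Q z w = (\<integral>s. of_real (1 + s\<^sup>2) / ((z - of_real s) * (w - of_real s)) \<partial>\<rho>)"

lemma cmod_kernel_product_le:
  "cmod (of_real (1 + s\<^sup>2) / ((z - of_real s) * (w - of_real s)))
     \<le> (poisson_kernel z s + poisson_kernel w s) / 2"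
proof -
  define p q where "p = 1 / cmod (z - of_real s)" and "q = 1 / cmod (w - of_real s)"
  have "p * q \<le> (p\<^sup>2 + q\<^sup>2) / 2"
    using sum_squares_ge_zero[of "p - q" 0] by (simp add: power2_eq_square algebra_simps)
  then have "(1 + s\<^sup>2) * (p * q) \<le> (1 + s\<^sup>2) * ((p\<^sup>2 + q\<^sup>2) / 2)"
    by (intro mult_left_mono) auto
  moreover have "cmod (of_real (1 + s\<^sup>2)) = 1 + s\<^sup>2" by (simp only: norm_of_real) simp
  ultimately show ?thesis
    by (simp add: norm_divide norm_mult p_def q_def poisson_kernel_def power_divide add_divide_distrib
        distrib_left del: of_real_add)
qed

text \<open>With \<open>p = 1/(z - s)\<close> and \<open>q = 1/(w - s)\<close> this is \<open>|p|\<^sup>2 + |q|\<^sup>2 - 2 Re (p q) = |p - cnj q|\<^sup>2\<close>. The last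
term is what makes the estimate of \<open>Re Q\<close> strict.\<close>

lemma Re_kernel_product:
  assumes "z \<noteq> of_real s" "w \<noteq> of_real s"
  shows "Re (of_real (1 + s\<^sup>2) / ((z - of_real s) * (w - of_real s)))
     = (poisson_kernel z s + poisson_kernel w s) / 2
       - (1 + s\<^sup>2) * (cmod (1 / (z - of_real s) - cnj (1 / (w - of_real s))))\<^sup>2 / 2"
proof -
  define p q where "p = 1 / (z - of_real s)" and "q = 1 / (w - of_real s)"
  have "(cmod (p - cnj q))\<^sup>2 = (cmod p)\<^sup>2 + (cmod q)\<^sup>2 - 2 * Re (p * q)"
    unfolding cmod_power2 by (simp add: power2_eq_square algebra_simps)
  then have pq: "Re (p * q) = ((cmod p)\<^sup>2 + (cmod q)\<^sup>2) / 2 - (cmod (p - cnj q))\<^sup>2 / 2"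
    by (simp add: field_simps)
  have K: "poisson_kernel z s = (1 + s\<^sup>2) * (cmod p)\<^sup>2" "poisson_kernel w s = (1 + s\<^sup>2) * (cmod q)\<^sup>2"
    by (simp_all add: poisson_kernel_def p_def q_def norm_divide power_divide)
  have "of_real (1 + s\<^sup>2) / ((z - of_real s) * (w - of_real s)) = of_real (1 + s\<^sup>2) * (p * q)"
    by (simp add: p_def q_def)
  then have "Re (of_real (1 + s\<^sup>2) / ((z - of_real s) * (w - of_real s))) = (1 + s\<^sup>2) * Re (p * q)"
    by (simp only: scaleR_conv_of_real[symmetric] scaleR_complex.sel)
  also have "c * ((A + B) / 2 - D / 2) = (c * A + c * B) / 2 - c * D / 2" for c A B D :: real
    by (simp add: field_simps)
  then have "(1 + s\<^sup>2) * Re (p * q)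
      = (poisson_kernel z s + poisson_kernel w s) / 2 - (1 + s\<^sup>2) * (cmod (p - cnj q))\<^sup>2 / 2"
    unfolding pq K .
  finally show ?thesis unfolding p_def q_def .
qed

lemma integrable_Q:
  assumes "z \<in> extended_domain" "w \<in> extended_domain"
  shows "integrable \<rho> (\<lambda>s. of_real (1 + s\<^sup>2) / ((z - of_real s) * (w - of_real s)))"
proof (rule Bochner_Integration.integrable_bound)
  show "integrable \<rho> (\<lambda>s. (poisson_kernel z s + poisson_kernel w s) / 2)"
    using assms by (auto simp: extended_domain_def)
  show "AE s in \<rho>. cmod (of_real (1 + s\<^sup>2) / ((z - of_real s) * (w - of_real s)))
      \<le> norm ((poisson_kernel z s + poisson_kernel w s) / 2)"
    using cmod_kernel_product_le by (intro AE_I2) (simp add: abs_of_nonneg del: of_real_add)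
qed measurable

lemma cmod_Q_le:
  assumes "z \<in> extended_domain" "w \<in> extended_domain"
  shows "cmod (Q z w) \<le> (P z + P w) / 2"
proof -
  have "cmod (Q z w) \<le> (\<integral>s. (poisson_kernel z s + poisson_kernel w s) / 2 \<partial>\<rho>)"
    unfolding Q_def using assms cmod_kernel_product_le
    by (intro Bochner_Integration.integral_norm_bound_integral integrable_Q) (auto simp: extended_domain_def)
  also have "\<dots> = (P z + P w) / 2"
    using assms by (simp add: extended_domain_def poisson_int_def)
  finally show ?thesis .
qed

text \<open>Equality would force \<open>z = cnj w\<close>, which in the closed upper half-plane only happens for \<open>z = w\<close> real.\<close>

lemma Re_Q_less:
  assumes z: "z \<in> extended_domain" and w: "w \<in> extended_domain" and ne: "z \<noteq> w \<or> 0 < Im z"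
  shows "Re (Q z w) < (P z + P w) / 2"
proof -
  have "z \<noteq> cnj w"
    using z w ne by (auto simp: extended_domain_def complex_eq_iff)
  have "Re (Q z w) = (\<integral>s. Re (of_real (1 + s\<^sup>2) / ((z - of_real s) * (w - of_real s))) \<partial>\<rho>)"
    unfolding Q_def by (rule integral_Re[OF integrable_Q[OF z w], symmetric])
  also have "\<dots> < (\<integral>s. (poisson_kernel z s + poisson_kernel w s) / 2 \<partial>\<rho>)"
  proof (intro integral_less_AE_space emeasure_space_nonzero nonzero integrable_Re integrable_Q z w)
    show "integrable \<rho> (\<lambda>s. (poisson_kernel z s + poisson_kernel w s) / 2)"
      using z w by (auto simp: extended_domain_def)
    have "AE s in \<rho>. z \<noteq> of_real s \<and> w \<noteq> of_real s" using z w by (auto simp: extended_domain_def)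
    then show "AE s in \<rho>. Re (of_real (1 + s\<^sup>2) / ((z - of_real s) * (w - of_real s)))
        < (poisson_kernel z s + poisson_kernel w s) / 2"
    proof (rule AE_mp[OF _ AE_I2], intro impI)
      fix s assume s: "z \<noteq> of_real s \<and> w \<noteq> of_real s"
      have "1 / (z - of_real s) \<noteq> cnj (1 / (w - of_real s))"
        using s \<open>z \<noteq> cnj w\<close> by (auto simp: divide_simps)
      then have "0 < (1 + s\<^sup>2) * (cmod (1 / (z - of_real s) - cnj (1 / (w - of_real s))))\<^sup>2"
        by (intro mult_pos_pos one_plus_sq_pos) simp
      then show "Re (of_real (1 + s\<^sup>2) / ((z - of_real s) * (w - of_real s)))
          < (poisson_kernel z s + poisson_kernel w s) / 2"
        using Re_kernel_product[of z s w] s by linarith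
    qed
  qed
  also have "\<dots> = (P z + P w) / 2"
    using z w by (simp add: extended_domain_def poisson_int_def)
  finally show ?thesis .
qed

lemma integrable_levy_kernel_extended:
  assumes z: "z \<in> extended_domain"
  shows "integrable \<rho> (\<lambda>s. (1 + of_real s * z) / (z - of_real s))"
proof -
  have "integrable \<rho> (\<lambda>s. 1 / (z - of_real s))"
  proof (rule Bochner_Integration.integrable_bound)
    show "integrable \<rho> (\<lambda>s. 1 + poisson_kernel z s)"
      using z by (auto simp: extended_domain_def)
    have "cmod (1 / (z - of_real s)) \<le> 1 + poisson_kernel z s" for s
    proof -
      define p where "p = 1 / cmod (z - of_real s)"
      have "p \<le> 1 + p\<^sup>2"
        using sum_squares_ge_zero[of "p - 1 / 2" 0] by (simp add: power2_eq_square algebra_simps)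
      also have "p\<^sup>2 \<le> poisson_kernel z s"
        unfolding p_def poisson_kernel_def by (simp add: power_divide divide_right_mono)
      finally show ?thesis by (simp add: p_def norm_divide)
    qed
    then show "AE s in \<rho>. cmod (1 / (z - of_real s)) \<le> norm (1 + poisson_kernel z s)"
      by (intro AE_I2) (simp add: abs_of_nonneg add_nonneg_nonneg)
  qed measurable
  then have "integrable \<rho> (\<lambda>s. (1 + z\<^sup>2) * (1 / (z - of_real s)) - z)"
    by (intro Bochner_Integration.integrable_diff integrable_mult_right) auto
  moreover have "AE s in \<rho>. (1 + z\<^sup>2) * (1 / (z - of_real s)) - z = (1 + of_real s * z) / (z - of_real s)"
    using z levy_kernel_eq[of z] by (auto simp: extended_domain_def elim!: eventually_mono)
  ultimately show ?thesis by (subst (asm) integrable_cong_AE) auto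
qed

lemma H_diff:
  assumes z: "z \<in> extended_domain" and w: "w \<in> extended_domain"
  shows "H z - H w = (z - w) * (1 - Q z w)"
proof -
  have "levy_integral \<rho> z - levy_integral \<rho> w =
      (\<integral>s. (1 + of_real s * z) / (z - of_real s) - (1 + of_real s * w) / (w - of_real s) \<partial>\<rho>)"
    unfolding levy_integral_def
    by (intro Bochner_Integration.integral_diff[symmetric] integrable_levy_kernel_extended z w)
  also have "\<dots> = (\<integral>s. - (z - w) * (of_real (1 + s\<^sup>2) / ((z - of_real s) * (w - of_real s))) \<partial>\<rho>)"
  proof (rule integral_cong_AE)
    have "AE s in \<rho>. z \<noteq> of_real s \<and> w \<noteq> of_real s" using z w by (auto simp: extended_domain_def)
    then show "AE s in \<rho>. (1 + of_real s * z) / (z - of_real s) - (1 + of_real s * w) / (w - of_real s) =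
       - (z - w) * (of_real (1 + s\<^sup>2) / ((z - of_real s) * (w - of_real s)))"
    proof (rule AE_mp[OF _ AE_I2], intro impI)
      fix s assume "z \<noteq> of_real s \<and> w \<noteq> of_real s"
      then show "(1 + of_real s * z) / (z - of_real s) - (1 + of_real s * w) / (w - of_real s) =
       - (z - w) * (of_real (1 + s\<^sup>2) / ((z - of_real s) * (w - of_real s)))"
        by (simp add: diff_frac_eq) (simp add: algebra_simps power2_eq_square)
    qed
  qed measurable
  also have "\<dots> = - (z - w) * Q z w"
    unfolding Q_def by (rule integral_mult_right_zero)
  finally show ?thesis by (simp add: H_def algebra_simps)
qed

lemma Im_H:
  assumes "z \<in> extended_domain"
  shows "Im (H z) = Im z * (1 - P z)"
proof -
  have "Im (levy_integral \<rho> z) = (\<integral>s. Im ((1 + of_real s * z) / (z - of_real s)) \<partial>\<rho>)"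
    unfolding levy_integral_def
    by (rule integral_Im[OF integrable_levy_kernel_extended[OF assms], symmetric])
  then have "Im (levy_integral \<rho> z) = - Im z * P z"
    unfolding Im_levy_kernel by (simp add: poisson_int_def)
  then show ?thesis by (simp add: H_def algebra_simps)
qed

lemma H_curve_real: "H (curve x) = of_real (Re (H (curve x)))"
proof -
  have "height x * (1 - P (curve x)) = 0"
    using height_eq_iff[of "height x" x] height_nonneg[of x] by (auto simp: curve_def less_le)
  then have "Im (H (curve x)) = 0" by (simp add: Im_H[OF curve_in_extended_domain])
  then show ?thesis by (simp add: complex_eq_iff)
qed

text \<open>On the curve \<open>P \<le> 1\<close>, so \<open>Re Q < 1\<close> for distinct points and the factor \<open>1 - Q\<close> in the difference of values does not vanish.\<close>

lemma inj_H_curve: "inj (\<lambda>x. Re (H (curve x)))"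
proof (rule injI)
  fix x x' assume "Re (H (curve x)) = Re (H (curve x'))"
  then have "H (curve x) = H (curve x')" using H_curve_real[of x] H_curve_real[of x'] by metis
  then have "(curve x - curve x') * (1 - Q (curve x) (curve x')) = 0"
    using H_diff[OF curve_in_extended_domain curve_in_extended_domain, of x x'] by simp
  moreover have "1 - Q (curve x) (curve x') \<noteq> 0" if "curve x \<noteq> curve x'"
  proof -
    have "Re (Q (curve x) (curve x')) < 1"
      using Re_Q_less[OF curve_in_extended_domain curve_in_extended_domain, of x x'] that
        P_curve_le[of x] P_curve_le[of x'] by simp
    then show ?thesis by auto
  qed
  ultimately have "curve x = curve x'" by auto
  then show "x = x'" by (metis Re_curve)
qed

text \<open>Because \<open>|Q| \<le> 1\<close>, the map \<open>H\<close> is Lipschitz with constant 2 on \<open>Omega\<close> and the curve together, even at points of the curve on the real axis.\<close>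

lemma H_tendsto_on_Omega:
  "(H \<longlongrightarrow> H (curve x)) (at (curve x) within Omega)"
proof -
  have "cmod (H z - H (curve x)) \<le> cmod (z - curve x) * 2" if "z \<in> Omega" for z
  proof -
    have z: "z \<in> extended_domain" "P z \<le> 1"
      using that upper_in_extended_domain by (auto simp: Omega_def)
    have "cmod (Q z (curve x)) \<le> 1"
      using cmod_Q_le[OF z(1) curve_in_extended_domain, of x] z(2) P_curve_le[of x] by simp
    then have "cmod (1 - Q z (curve x)) \<le> 2"
      using norm_triangle_ineq4[of 1 "Q z (curve x)"] by simp
    then show ?thesis
      by (simp add: H_diff[OF z(1) curve_in_extended_domain] norm_mult mult_left_mono)
  qed
  then have ev: "\<forall>\<^sub>F z in at (curve x) within Omega. cmod (H z - H (curve x)) \<le> cmod (z - curve x) * 2"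
    by (auto simp: eventually_at_filter)
  have "((\<lambda>z. cmod (z - curve x) * 2) \<longlongrightarrow> cmod (curve x - curve x) * 2) (at (curve x) within Omega)"
    by (intro tendsto_intros)
  then have "((\<lambda>z. H z - H (curve x)) \<longlongrightarrow> 0) (at (curve x) within Omega)"
    by (intro Lim_null_comparison[OF ev]) simp
  then show ?thesis by (rule LIM_zero_cancel)
qed

lemma curve_islimpt_Omega: "at (curve x) within Omega \<noteq> bot"
proof -
  have "curve x islimpt Omega"
    unfolding islimpt_approachable
  proof (intro allI impI)
    fix e :: real assume e: "0 < e"
    define z where "z = Complex x (height x + e / 2)"
    have "z \<in> Omega"
      using height_less_iff[of "height x + e / 2" x] height_nonneg[of x] e by (simp add: Omega_def z_def)
    moreover have "z \<noteq> curve x" using e by (simp add: z_def curve_def)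
    moreover have "dist z (curve x) < e"
    proof -
      have "z - curve x = of_real (e / 2) * \<i>" by (simp add: z_def curve_def complex_eq_iff)
      then have "dist z (curve x) = e / 2"
        using e by (simp add: dist_norm norm_mult del: of_real_divide)
      then show ?thesis using e by simp
    qed
    ultimately show "\<exists>z\<in>Omega. z \<noteq> curve x \<and> dist z (curve x) < e" by blast
  qed
  then show ?thesis by (simp add: trivial_limit_within)
qed

end

section \<open>Analytic parametrization of a curve that stays off the real axis\<close>

context levy_perturbation
begin

text \<open>The derivative of \<open>(1 + z\<^sup>2) G(z) - \<rho>(\<real>) z\<close> is \<open>- Q(z, z)\<close>, by an identity between the integrands.\<close>

lemma H_has_field_derivative:
  assumes z: "0 < Im z"
  shows "(H has_field_derivative 1 - Q z z) (at z)"
proof -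
  let ?D = "2 * z * cauchy_transform \<rho> z + (1 + z\<^sup>2) * - (\<integral>s. 1 / (z - of_real s)\<^sup>2 \<partial>\<rho>)
      - of_real (measure \<rho> UNIV)"
  have "((\<lambda>z. of_real a + z + ((1 + z\<^sup>2) * cauchy_transform \<rho> z - of_real (measure \<rho> UNIV) * z))
      has_field_derivative (1 + ?D)) (at z)"
    by (auto intro!: derivative_eq_intros cauchy_transform_has_derivative[OF z] simp: algebra_simps)
  then have der: "(H has_field_derivative (1 + ?D)) (at z)"
  proof (rule has_field_derivative_transform_within_open[OF _ open_upper_half_plane])
    show "of_real a + w + ((1 + w\<^sup>2) * cauchy_transform \<rho> w - of_real (measure \<rho> UNIV) * w) = H w"
      if "w \<in> upper_half_plane" for w
      using that by (simp add: H_def levy_integral_eq_cauchy)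
  qed (use z in simp)
  have zQ: "z \<in> extended_domain" by (rule upper_in_extended_domain[OF z])
  have G: "integrable \<rho> (\<lambda>s. 1 / (z - complex_of_real s))" by (rule integrable_cauchy_kernel[OF z])
  have intQ: "integrable \<rho> (\<lambda>s. of_real (1 + s\<^sup>2) / ((z - of_real s) * (z - of_real s)))"
    by (rule integrable_Q[OF zQ zQ])
  have pt: "- (of_real (1 + s\<^sup>2) / ((z - of_real s) * (z - of_real s)))
      = 2 * z * (1 / (z - of_real s)) - (1 + z\<^sup>2) * (1 / (z - of_real s)\<^sup>2) - 1" for s
    using upper_ne_real[OF z, of s] by (simp add: divide_simps) (simp add: algebra_simps power2_eq_square)
  have G2: "integrable \<rho> (\<lambda>s. (1 + z\<^sup>2) * (1 / (z - complex_of_real s)\<^sup>2))"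
  proof -
    have "integrable \<rho> (\<lambda>s. 2 * z * (1 / (z - complex_of_real s)) - 1
        - - (of_real (1 + s\<^sup>2) / ((z - of_real s) * (z - of_real s))))"
      by (intro Bochner_Integration.integrable_diff integrable_mult_right G integrable_minus intQ) simp
    then show ?thesis unfolding pt by simp
  qed
  have "- Q z z = (\<integral>s. - (of_real (1 + s\<^sup>2) / ((z - of_real s) * (z - of_real s))) \<partial>\<rho>)"
    unfolding Q_def by (rule Bochner_Integration.integral_minus[symmetric])
  also have "\<dots> = (\<integral>s. 2 * z * (1 / (z - of_real s)) \<partial>\<rho>)
      - (\<integral>s. (1 + z\<^sup>2) * (1 / (z - of_real s)\<^sup>2) \<partial>\<rho>) - (\<integral>s. 1 \<partial>\<rho>)"
    unfolding pt using G2 G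
    by (subst Bochner_Integration.integral_diff, simp_all del: times_divide_eq_right)
  also have "\<dots> = ?D"
    unfolding cauchy_transform_def integral_mult_right_zero
    by (simp add: space_UNIV scaleR_conv_of_real)
  finally have "- Q z z = ?D" .
  then have "1 - Q z z = 1 + ?D" by (simp only: diff_conv_add_uminus[of 1 "Q z z"])
  with der show ?thesis by (simp only:)
qed

lemma H_holomorphic: "H holomorphic_on upper_half_plane"
  unfolding holomorphic_on_open[OF open_upper_half_plane] using H_has_field_derivative by auto blast

text \<open>In the upper half-plane the curve is exactly the real locus of \<open>H\<close>, so any preimage of a real number there lies on it.\<close>

lemma Im_H_eq_0_imp_on_curve:
  assumes "0 < Im z" "Im (H z) = 0"
  shows "curve (Re z) = z" "of_real (Re (H (curve (Re z)))) = H z"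
proof -
  have "P z = 1" using assms Im_H[OF upper_in_extended_domain[OF assms(1)]] by simp
  then have "height (Re z) = Im z" using height_eq_iff[OF assms(1), of "Re z"] by simp
  then show c: "curve (Re z) = z" by (simp add: curve_def)
  show "of_real (Re (H (curve (Re z)))) = H z" unfolding c using assms(2) by (simp add: complex_eq_iff)
qed

lemma local_inverse_on_curve:
  assumes h: "0 < height x"
  obtains \<epsilon> g where "0 < \<epsilon>" "g holomorphic_on ball (H (curve x)) \<epsilon>"
    "\<And>w. w \<in> ball (H (curve x)) \<epsilon> \<Longrightarrow> 0 < Im (g w) \<and> H (g w) = w"
proof -
  have c: "0 < Im (curve x)" using h by simp
  have "Re (Q (curve x) (curve x)) < 1"
    using Re_Q_less[OF curve_in_extended_domain curve_in_extended_domain, of x x] c P_curve_le[of x] by simp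
  then have "deriv H (curve x) \<noteq> 0"
    using DERIV_imp_deriv[OF H_has_field_derivative[OF c]] by auto
  then obtain r where r: "0 < r" "ball (curve x) r \<subseteq> upper_half_plane" "inj_on H (ball (curve x) r)"
    using has_complex_derivative_locally_injective[OF H_holomorphic _ open_upper_half_plane, of "curve x"] c
    by auto
  let ?S = "ball (curve x) r"
  have hol: "H holomorphic_on ?S" by (rule holomorphic_on_subset[OF H_holomorphic r(2)])
  obtain g where g: "g holomorphic_on (H ` ?S)" "\<And>z. z \<in> ?S \<Longrightarrow> g (H z) = z"
    using holomorphic_has_inverse[OF hol open_ball r(3)] by metis
  have "open (H ` ?S)" by (rule open_mapping_thm3[OF hol open_ball r(3)])
  moreover have "H (curve x) \<in> H ` ?S" using r(1) by simp
  ultimately obtain \<epsilon> where e: "0 < \<epsilon>" "ball (H (curve x)) \<epsilon> \<subseteq> H ` ?S"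
    by (meson open_contains_ball)
  have "0 < Im (g w) \<and> H (g w) = w" if "w \<in> ball (H (curve x)) \<epsilon>" for w
    using that e(2) g(2) r(2) by (force simp: subset_iff)
  then show ?thesis by (intro that[OF e(1) holomorphic_on_subset[OF g(1) e(2)]])
qed

lemma open_range_H_curve:
  assumes "\<And>x. 0 < height x"
  shows "open (range (\<lambda>x. Re (H (curve x))))"
proof (rule openI)
  fix t assume "t \<in> range (\<lambda>x. Re (H (curve x)))"
  then obtain x where x: "t = Re (H (curve x))" by auto
  obtain \<epsilon> g where e: "0 < \<epsilon>" and g: "\<And>w. w \<in> ball (H (curve x)) \<epsilon> \<Longrightarrow> 0 < Im (g w) \<and> H (g w) = w"
    using local_inverse_on_curve[OF assms] by metis
  have "u \<in> range (\<lambda>x. Re (H (curve x)))" if "u \<in> ball t \<epsilon>" for u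
  proof -
    have "dist (H (curve x)) (of_real u) = dist t u"
      unfolding x by (subst H_curve_real) (simp only: dist_of_real)
    then have "0 < Im (g (of_real u)) \<and> H (g (of_real u)) = of_real u" using that by (intro g) simp
    then have "Re (H (curve (Re (g (of_real u))))) = u"
      using Im_H_eq_0_imp_on_curve(1)[of "g (of_real u)"] by simp
    then show ?thesis by (metis rangeI)
  qed
  then show "\<exists>\<epsilon>>0. ball t \<epsilon> \<subseteq> range (\<lambda>x. Re (H (curve x)))" using e by blast
qed

text \<open>A convergent sequence of values comes from a bounded sequence of points of the curve. A limit point
of these on the real axis would have \<open>P \<le> 1\<close> above it, hence height 0; so it lies in the upper
half-plane, where \<open>H\<close> is continuous.\<close>

lemma closed_range_H_curve:
  assumes pos: "\<And>x. 0 < height x"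
  shows "closed (range (\<lambda>x. Re (H (curve x))))"
  unfolding closed_sequential_limits
proof (intro allI impI, elim conjE)
  fix T t assume T: "\<forall>n. T n \<in> range (\<lambda>x. Re (H (curve x)))" and lim: "T \<longlonglongrightarrow> t"
  from T obtain X where X: "\<And>n. T n = Re (H (curve (X n)))" by (auto simp: image_iff) metis
  have TX: "H (curve (X n)) = of_real (T n)" for n using H_curve_real X by simp
  \<comment> \<open>\<open>H\<close> expands distances to a point of the open domain by a definite factor, so it is proper.\<close>
  obtain y where y: "0 < y" "P (Complex 0 y) < 1" using ex_P_less_1[of 0] by auto
  define w where "w = Complex 0 y"
  have w: "w \<in> extended_domain" using y by (simp add: w_def upper_in_extended_domain)
  define c where "c = (1 - P w) / 2"
  have c: "0 < c" using y by (simp add: c_def w_def)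
  have expand: "cmod (curve x - w) * c \<le> cmod (H (curve x) - H w)" for x
  proof -
    have "cmod (Q (curve x) w) \<le> 1 - c"
      using cmod_Q_le[OF curve_in_extended_domain w, of x] P_curve_le[of x] by (simp add: c_def field_simps)
    moreover have "1 \<le> cmod (1 - Q (curve x) w) + cmod (Q (curve x) w)"
      using norm_triangle_ineq[of "1 - Q (curve x) w" "Q (curve x) w"] by simp
    ultimately have "c \<le> cmod (1 - Q (curve x) w)" by simp
    then show ?thesis unfolding H_diff[OF curve_in_extended_domain w] norm_mult by (intro mult_left_mono) auto
  qed
  have "Bseq T" using lim by (rule convergent_imp_Bseq[OF convergentI])
  then obtain B where B: "\<And>n. \<bar>T n\<bar> \<le> B" by (auto simp: Bseq_def)
  have "cmod (curve (X n)) \<le> (B + cmod (H w)) / c + cmod w" for n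
  proof -
    have "cmod (curve (X n) - w) * c \<le> B + cmod (H w)"
      using expand[of "X n"] norm_triangle_ineq4[of "H (curve (X n))" "H w"] B[of n] by (simp add: TX)
    then have "cmod (curve (X n) - w) \<le> (B + cmod (H w)) / c" using c by (simp add: field_simps)
    then show ?thesis using norm_triangle_ineq[of "curve (X n) - w" w] by simp
  qed
  then have "bounded (range (\<lambda>n. curve (X n)))" by (auto simp: bounded_iff)
  then obtain z k where k: "strict_mono k" and "((\<lambda>n. curve (X n)) \<circ> k) \<longlonglongrightarrow> z"
    using bounded_imp_convergent_subsequence by blast
  then have z: "(\<lambda>n. curve (X (k n))) \<longlonglongrightarrow> z" by (simp add: o_def)
  have Tk: "(\<lambda>n. T (k n)) \<longlonglongrightarrow> t" using LIMSEQ_subseq_LIMSEQ[OF lim k] by (simp add: o_def)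
  have "0 < Im z"
  proof (rule ccontr)
    assume "\<not> 0 < Im z"
    moreover have "0 \<le> Im z"
      by (rule tendsto_lowerbound[OF tendsto_Im[OF z]]) (auto simp: height_nonneg)
    ultimately have Im0: "Im z = 0" by simp
    have le1: "P (Complex (Re z) y) \<le> 1" if "0 < y" for y
    proof (rule tendsto_upperbound)
      show "(\<lambda>n. P (Complex (Re (curve (X (k n)))) y)) \<longlonglongrightarrow> P (Complex (Re z) y)"
        using that by (intro poisson_int_tendsto tendsto_Complex tendsto_Re[OF z] tendsto_const) simp
      have "\<forall>\<^sub>F n in sequentially. Im (curve (X (k n))) < y"
        using Im0 that by (intro order_tendstoD(2)[OF tendsto_Im[OF z]]) simp
      then show "\<forall>\<^sub>F n in sequentially. P (Complex (Re (curve (X (k n)))) y) \<le> 1"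
        by eventually_elim (use that height_less_iff in \<open>force intro: less_imp_le\<close>)
    qed simp
    have "height (Re z) < y" if "0 < y" for y
      using poisson_int_strict_antimono[OF nonzero, of "y / 2" y "Re z"] le1[of "y / 2"] that
      by (simp add: height_less_iff)
    then have "height (Re z) \<le> 0" by (meson less_irrefl not_le)
    with pos[of "Re z"] show False by simp
  qed
  then have "isCont H z" by (rule DERIV_isCont[OF H_has_field_derivative])
  then have "(\<lambda>n. H (curve (X (k n)))) \<longlonglongrightarrow> H z" using z by (rule isCont_tendsto_compose)
  moreover have "(\<lambda>n. H (curve (X (k n)))) \<longlonglongrightarrow> of_real t"
    unfolding TX by (intro tendsto_of_real Tk)
  ultimately have "H z = of_real t" by (rule LIMSEQ_unique)
  then have "Re (H (curve (Re z))) = t"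
    using Im_H_eq_0_imp_on_curve(1)[OF \<open>0 < Im z\<close>] by simp
  then show "t \<in> range (\<lambda>x. Re (H (curve x)))" by (metis rangeI)
qed

lemma bij_H_curve:
  assumes "\<And>x. 0 < height x"
  shows "bij (\<lambda>x. Re (H (curve x)))"
proof -
  have "range (\<lambda>x. Re (H (curve x))) = UNIV"
    using clopen[of "range (\<lambda>x. Re (H (curve x)))"] open_range_H_curve[OF assms] closed_range_H_curve[OF assms]
    by auto
  with inj_H_curve show ?thesis by (simp add: bij_def)
qed

end

section \<open>The density of the free convolution\<close>

text \<open>The real power series is obtained by taking imaginary parts of the coefficients of the complex one.\<close>

lemma real_analytic_at_Im:
  fixes p :: "real \<Rightarrow> real" and g :: "complex \<Rightarrow> complex"
  assumes e: "0 < \<epsilon>" and hol: "g holomorphic_on ball (of_real t) \<epsilon>"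
    and p: "\<And>u. \<bar>u - t\<bar> < \<epsilon> \<Longrightarrow> p u = Im (g (of_real u))"
  shows "real_analytic_at p t"
proof -
  have hol0: "(\<lambda>w. g (of_real t + w)) holomorphic_on ball 0 \<epsilon>"
    by (rule holomorphic_on_compose_gen[OF _ hol, unfolded o_def])
      (auto intro!: holomorphic_intros simp: dist_norm)
  then have "(\<lambda>w. g (of_real t + w)) analytic_on {0}"
    unfolding analytic_at using e by (intro exI[of _ "ball 0 \<epsilon>"]) simp
  then obtain C where C: "(\<lambda>w. g (of_real t + w)) has_fps_expansion C"
    using analytic_at_imp_has_fps_expansion_0 by blast
  define R where "R = Abs_fps (\<lambda>n. Im (fps_nth C n))"
  have Im_term: "Im (fps_nth C n * of_real u ^ n) = fps_nth R n * u ^ n" for n u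
    by (simp add: R_def flip: of_real_power)
  have rad: "fps_conv_radius C \<le> fps_conv_radius R"
    unfolding fps_conv_radius_def[of R]
  proof (rule conv_radius_geI_ex)
    fix r :: real assume r: "0 < r" "ereal r < fps_conv_radius C"
    then have "summable (\<lambda>n. fps_nth C n * of_real r ^ n)" by (intro summable_fps) simp
    from summable_Im[OF this] have "summable (\<lambda>n. fps_nth R n * r ^ n)" by (simp only: Im_term)
    then show "\<exists>z. norm z = r \<and> summable (\<lambda>n. fps_nth R n * z ^ n)" using r by (intro exI[of _ r]) simp
  qed
  have pos: "0 < fps_conv_radius C" and ev: "\<forall>\<^sub>F w in nhds 0. eval_fps C w = g (of_real t + w)"
    using C unfolding has_fps_expansion_def by (rule conjunct1, rule conjunct2)
  have "\<forall>\<^sub>F w in nhds (0::complex). w \<in> eball 0 (fps_conv_radius C)"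
    using pos by (intro eventually_nhds_in_open) (auto simp: zero_ereal_def)
  with ev have ev': "\<forall>\<^sub>F w in nhds 0. eval_fps C w = g (of_real t + w) \<and> ereal (norm w) < fps_conv_radius C"
    by eventually_elim auto
  have "filterlim complex_of_real (nhds 0) (nhds (0 :: real))"
    using tendsto_of_real[OF filterlim_ident[of "nhds (0 :: real)"], where ?'a = complex] by simp
  from filterlim_iff[THEN iffD1, OF this, rule_format, OF ev']
  have ev'': "\<forall>\<^sub>F u in nhds 0. eval_fps C (of_real u) = g (of_real t + of_real u) \<and>
      ereal \<bar>u\<bar> < fps_conv_radius C" by simp
  have near: "\<forall>\<^sub>F u in nhds 0. u \<in> ball (0 :: real) \<epsilon>"
    using e by (intro eventually_nhds_in_open) auto
  have "\<forall>\<^sub>F u in nhds 0. eval_fps R u = p (t + u)"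
    using ev'' near
  proof eventually_elim
    fix u assume *: "eval_fps C (of_real u) = g (of_real t + of_real u) \<and> ereal \<bar>u\<bar> < fps_conv_radius C"
      and u: "u \<in> ball 0 \<epsilon>"
    have "(\<lambda>n. fps_nth C n * of_real u ^ n) sums eval_fps C (of_real u)"
      using * by (intro sums_eval_fps) simp
    from sums_Im[OF this] have "(\<lambda>n. fps_nth R n * u ^ n) sums Im (eval_fps C (of_real u))"
      by (simp only: Im_term)
    moreover have "(\<lambda>n. fps_nth R n * u ^ n) sums eval_fps R u"
      using * less_le_trans[OF _ rad] by (intro sums_eval_fps) simp
    ultimately have "eval_fps R u = Im (eval_fps C (of_real u))" by (rule sums_unique2[symmetric])
    then show "eval_fps R u = p (t + u)"
      using * p[of "t + u"] u by simp
  qed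
  then show ?thesis
    unfolding real_analytic_at_def has_fps_expansion_def using pos rad by (intro exI[of _ R]) auto
qed

context levy_and_distribution
begin

abbreviation \<rho> :: "real measure" where "\<rho> \<equiv> subord_rho \<phi> \<nu>"

definition shift :: real where
  "shift = (SOME a. \<forall>z \<in> upper_half_plane. subord_H \<phi> \<nu> z = of_real a + z + levy_integral \<rho> z)"

lemma rho_representation:
  "finite_borel_measure \<rho>" "\<rho> \<noteq> null_measure borel"
  "z \<in> upper_half_plane \<Longrightarrow> subord_H \<phi> \<nu> z = of_real shift + z + levy_integral \<rho> z"
proof -
  have *: "finite_borel_measure \<rho> \<and> \<rho> \<noteq> null_measure borel \<and>
     (\<exists>a::real. \<forall>z \<in> upper_half_plane. subord_H \<phi> \<nu> z = of_real a + z + levy_integral \<rho> z)"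
    unfolding subord_rho_def by (rule someI_ex[OF ex_representing_measure])
  then show "finite_borel_measure \<rho>" "\<rho> \<noteq> null_measure borel" by auto
  have "\<forall>z \<in> upper_half_plane. subord_H \<phi> \<nu> z = of_real shift + z + levy_integral \<rho> z"
    unfolding shift_def by (rule someI_ex) (use * in blast)
  then show "z \<in> upper_half_plane \<Longrightarrow> subord_H \<phi> \<nu> z = of_real shift + z + levy_integral \<rho> z" by blast
qed

sublocale R: levy_perturbation \<rho> shift
  using rho_representation by (simp add: levy_perturbation_def levy_perturbation_axioms_def)

lemma subord_H_eq: "0 < Im z \<Longrightarrow> subord_H \<phi> \<nu> z = R.H z"
  using rho_representation(3)[of z] by (simp add: R.H_def)

text \<open>Both sides are \<open>- Im \<phi>(F(z))\<close>. This is the only property of \<open>\<rho>\<close> that enters the comparison with \<open>\<sigma>\<close>.\<close>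

lemma poisson_int_rho:
  assumes z: "0 < Im z"
  shows "Im z * poisson_int \<rho> z = Im (F z) * poisson_int \<sigma> (F z)"
proof -
  have "Im (R.H z) = Im z + Im (\<phi> (F z))" by (simp add: subord_H_eq[OF z, symmetric] subord_H_def)
  then show ?thesis
    by (simp add: R.Im_H[OF R.upper_in_extended_domain[OF z]] Im_phi_F[OF z] algebra_simps)
qed

lemma subord_f_eq: "subord_f \<phi> \<nu> = R.height"
  by (simp add: fun_eq_iff subord_f_def R.height_def poisson_int_def poisson_kernel_Complex)

lemma subord_Omega_eq: "subord_Omega \<phi> \<nu> = R.Omega"
proof -
  have "0 < Im (subord_H \<phi> \<nu> z) \<longleftrightarrow> poisson_int \<rho> z < 1" if "0 < Im z" for z
    using that by (simp add: subord_H_eq R.Im_H R.upper_in_extended_domain zero_less_mult_iff)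
  then show ?thesis by (auto simp: subord_Omega_def R.Omega_def)
qed

lemma subord_h_eq: "subord_h \<phi> \<nu> = (\<lambda>x. Re (R.H (R.curve x)))"
proof
  fix x
  have "(subord_H \<phi> \<nu> \<longlongrightarrow> R.H (R.curve x)) (at (R.curve x) within R.Omega)"
  proof (rule Lim_transform_eventually[OF R.H_tendsto_on_Omega])
    show "\<forall>\<^sub>F z in at (R.curve x) within R.Omega. R.H z = subord_H \<phi> \<nu> z"
      by (auto simp: eventually_at_filter R.Omega_def subord_H_eq)
  qed
  then have "Lim (at (R.curve x) within R.Omega) (subord_H \<phi> \<nu>) = R.H (R.curve x)"
    by (rule tendsto_Lim[OF R.curve_islimpt_Omega])
  then show "subord_h \<phi> \<nu> x = Re (R.H (R.curve x))"
    by (simp add: subord_h_def subord_f_eq subord_Omega_eq flip: R.curve_def)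
qed

lemma inv_subord_h: "inv (subord_h \<phi> \<nu>) (Re (R.H (R.curve x))) = x"
  using inv_f_f[OF R.inj_H_curve, of x] by (simp add: subord_h_eq)

lemma free_conv_density_curve:
  assumes "0 < R.height x"
  shows "free_conv_density \<phi> \<nu> (Re (R.H (R.curve x))) = - Im (cauchy_transform \<nu> (R.curve x)) / pi"
  using assms
  by (simp add: free_conv_density_def Let_def inv_subord_h subord_V_def subord_f_eq
      D.Im_cauchy_transform resolvent_sq_int_def cmod_diff_real_sq)

text \<open>Injectivity of \<open>h\<close> is essential: it ensures that the value of the density prescribed at \<open>h(x)\<close> is the one belonging to \<open>x\<close>.\<close>

lemma height_pos_if_density_pos:
  assumes "\<And>t. 0 < free_conv_density \<phi> \<nu> t"
  shows "0 < R.height x"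
proof (rule ccontr)
  assume "\<not> 0 < R.height x"
  then have "free_conv_density \<phi> \<nu> (Re (R.H (R.curve x))) = 0"
    by (simp add: free_conv_density_def Let_def inv_subord_h subord_V_def subord_f_eq)
  with assms show False by (metis less_irrefl)
qed

text \<open>Near \<open>t = h(x)\<close> the inverse of \<open>h\<close> is the real part of a local holomorphic inverse \<open>g\<close> of \<open>H\<close>, and
\<open>g(t)\<close> is the point of the curve above it; the density is \<open>- Im G\<^sub>\<nu>(g(t)) / \<pi>\<close>.\<close>

lemma density_pos_and_analytic:
  assumes pos: "\<And>x. 0 < R.height x"
  shows "0 < free_conv_density \<phi> \<nu> t" "real_analytic_at (free_conv_density \<phi> \<nu>) t"
proof -
  obtain x where x: "t = Re (R.H (R.curve x))"
    using surjD[OF bij_is_surj[OF R.bij_H_curve[OF pos]], of t] by blast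
  show "0 < free_conv_density \<phi> \<nu> t"
    unfolding x free_conv_density_curve[OF pos] using D.Im_cauchy_transform_neg[of "R.curve x"] pos
    by (intro divide_pos_pos) simp_all
  have Ht: "R.H (R.curve x) = of_real t" unfolding x by (rule R.H_curve_real)
  obtain \<epsilon> g where e: "0 < \<epsilon>" and "g holomorphic_on ball (R.H (R.curve x)) \<epsilon>"
    and "\<And>w. w \<in> ball (R.H (R.curve x)) \<epsilon> \<Longrightarrow> 0 < Im (g w) \<and> R.H (g w) = w"
    by (rule R.local_inverse_on_curve[OF pos]) (rule that, assumption, assumption, iprover)
  note hol = this(2)[unfolded Ht] and g = this(3)[unfolded Ht]
  have "(\<lambda>w. cauchy_transform \<nu> (g w)) holomorphic_on ball (of_real t) \<epsilon>"
    by (rule holomorphic_on_compose_gen[OF hol D.cauchy_transform_holomorphic, unfolded o_def])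
      (use g in \<open>auto simp only: image_subset_iff in_upper_half_plane\<close>)
  then have "(\<lambda>w. - cauchy_transform \<nu> (g w) / of_real pi) holomorphic_on ball (of_real t) \<epsilon>"
    by (intro holomorphic_intros) auto
  then show "real_analytic_at (free_conv_density \<phi> \<nu>) t"
  proof (rule real_analytic_at_Im[OF e])
    fix u assume u: "\<bar>u - t\<bar> < \<epsilon>"
    have "dist (complex_of_real t) (of_real u) < \<epsilon>"
      using u by (simp only: dist_of_real dist_real_def abs_minus_commute)
    then have gu: "0 < Im (g (of_real u))" "R.H (g (of_real u)) = of_real u"
      using g[of "of_real u"] by simp_all
    note c = R.Im_H_eq_0_imp_on_curve[OF gu(1)]
    have "R.curve (Re (g (of_real u))) = g (of_real u)" using c(1) gu(2) by simp
    then show "free_conv_density \<phi> \<nu> u = Im (- cauchy_transform \<nu> (g (of_real u)) / of_real pi)"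
      using free_conv_density_curve[OF pos, of "Re (g (of_real u))"] gu(2) by simp
  qed
qed

end

section \<open>Sufficiency of the two conditions\<close>

context levy_and_distribution
begin

text \<open>If the height at \<open>x\<close> were 0, then \<open>Im F P\<^sub>\<sigma>(F) < y\<close> at \<open>x + iy\<close> for all \<open>y > 0\<close>, and in particular
\<open>P\<^sub>\<sigma>(F) < 1\<close>. Let \<open>W n\<close> be the values of \<open>F\<close> at heights \<open>1 / (n + 1)\<close>. A subsequential limit of \<open>W\<close> in the upper
half-plane contradicts the first inequality, and one on the real axis makes the
boundary integral there at most 1. If \<open>W\<close> is unbounded, the formula for \<open>Im F\<close> turns the first
inequality into a bound for \<open>|F|\<^sup>2 P\<^sub>\<sigma>(F)\<close>, whose integrand tends to \<open>1 + s\<^sup>2\<close> as \<open>|F|\<close> tends to infinity, and the second moment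
integral would be finite.\<close>

lemma height_pos_if_levy_conditions:
  assumes bdry: "\<And>x. 1 < boundary_integral \<sigma> x" and mom: "second_moment_integral \<sigma> = \<infinity>"
  shows "0 < R.height x"
proof (rule ccontr)
  assume "\<not> 0 < R.height x"
  then have h0: "R.height x = 0" using R.height_nonneg[of x] by simp
  define y where "y n = 1 / real (Suc n)" for n
  have y: "0 < y n" "y n \<le> 1" for n by (auto simp: y_def)
  have y0: "y \<longlonglongrightarrow> 0" unfolding y_def by (rule LIMSEQ_Suc[OF lim_inverse_n'])
  define W where "W n = F (Complex x (y n))" for n
  have W_pos: "0 < Im (W n)" for n using D.Im_recip_cauchy_pos[of "Complex x (y n)"] y by (simp add: W_def)
  have W_ge: "y n \<le> Im (W n)" for n using D.Im_recip_cauchy_ge[of "Complex x (y n)"] y by (simp add: W_def)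
  have ImWP: "Im (W n) * poisson_int \<sigma> (W n) < y n" for n
  proof -
    have "poisson_int \<rho> (Complex x (y n)) < 1" using R.height_less_iff[OF y(1), of x] h0 y by simp
    then have "y n * poisson_int \<rho> (Complex x (y n)) < y n * 1" using y by (intro mult_strict_left_mono)
    moreover have "y n * poisson_int \<rho> (Complex x (y n)) = Im (W n) * poisson_int \<sigma> (W n)"
      using poisson_int_rho[of "Complex x (y n)"] y by (simp add: W_def)
    ultimately show ?thesis by linarith
  qed
  have WP: "poisson_int \<sigma> (W n) < 1" for n
  proof -
    have "y n * poisson_int \<sigma> (W n) \<le> Im (W n) * poisson_int \<sigma> (W n)"
      by (intro mult_right_mono W_ge L.poisson_int_nonneg)
    also have "\<dots> < y n * 1" using ImWP by simp
    finally show ?thesis using y(1)[of n] by (simp only: mult_less_cancel_left_pos)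
  qed
  show False
  proof (cases "bounded (range W)")
    case True
    then obtain w k where k: "strict_mono k" and "(W \<circ> k) \<longlonglongrightarrow> w"
      using bounded_imp_convergent_subsequence by blast
    then have w: "(\<lambda>n. W (k n)) \<longlonglongrightarrow> w" by (simp add: o_def)
    have "0 \<le> Im w"
      by (rule tendsto_lowerbound[OF tendsto_Im[OF w]]) (auto intro!: always_eventually less_imp_le W_pos)
    then consider "0 < Im w" | "Im w = 0" by linarith
    then show False
    proof cases
      case 1
      have "Im w * poisson_int \<sigma> w \<le> 0"
      proof (rule LIMSEQ_le)
        show "(\<lambda>n. Im (W (k n)) * poisson_int \<sigma> (W (k n))) \<longlonglongrightarrow> Im w * poisson_int \<sigma> w"
          by (intro tendsto_mult tendsto_Im w L.poisson_int_tendsto 1)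
        show "(\<lambda>n. y (k n)) \<longlonglongrightarrow> 0" using LIMSEQ_subseq_LIMSEQ[OF y0 k] by (simp add: o_def)
      qed (auto intro!: less_imp_le ImWP)
      then show False using 1 L.poisson_int_pos[OF levy_nonzero 1] by (simp add: mult_le_0_iff)
    next
      case 2
      have "poisson_int \<sigma> (Complex (Re w) \<delta>) \<le> 1" if d: "0 < \<delta>" for \<delta>
      proof (rule tendsto_upperbound)
        show "(\<lambda>n. poisson_int \<sigma> (Complex (Re (W (k n))) \<delta>)) \<longlonglongrightarrow> poisson_int \<sigma> (Complex (Re w) \<delta>)"
          using d by (intro L.poisson_int_tendsto tendsto_Complex tendsto_Re[OF w] tendsto_const) simp
        have "\<forall>\<^sub>F n in sequentially. Im (W (k n)) < \<delta>"
          using 2 d by (intro order_tendstoD(2)[OF tendsto_Im[OF w]]) simp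
        then show "\<forall>\<^sub>F n in sequentially. poisson_int \<sigma> (Complex (Re (W (k n))) \<delta>) \<le> 1"
        proof eventually_elim
          fix n assume "Im (W (k n)) < \<delta>"
          then show "poisson_int \<sigma> (Complex (Re (W (k n))) \<delta>) \<le> 1"
            using L.poisson_int_strict_antimono[OF levy_nonzero W_pos, of "k n" \<delta> "Re (W (k n))"] WP[of "k n"]
            by simp
        qed
      qed simp
      then have "boundary_integral \<sigma> (Re w) \<le> 1"
        using L.poisson_int_le_imp_boundary_integral_le[of "Re w" 1] by simp
      with bdry[of "Re w"] show False by simp
    qed
  next
    case False
    \<comment> \<open>The resolvent integral increases as the axis is approached, so its value at height 1 is a lower bound.\<close>
    define c where "c = resolvent_sq_int \<nu> (Complex x 1)"
    have c: "0 < c" unfolding c_def by (rule D.resolvent_sq_int_pos) simp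
    have c_le: "c \<le> resolvent_sq_int \<nu> (Complex x (y n))" for n
      unfolding c_def resolvent_sq_int_def
    proof (intro integral_mono D.integrable_resolvent_sq)
      fix s
      have "0 < (y n)\<^sup>2" "(y n)\<^sup>2 \<le> 1" using y[of n] by (simp_all add: power_le_one)
      then show "1 / (cmod (Complex x 1 - of_real s))\<^sup>2 \<le> 1 / (cmod (Complex x (y n) - of_real s))\<^sup>2"
        unfolding cmod_diff_real_sq by (intro divide_left_mono mult_pos_pos) (auto intro: add_nonneg_pos)
    qed (use y in auto)
    have bound: "(cmod (W n))\<^sup>2 * poisson_int \<sigma> (W n) \<le> 1 / c" for n
    proof -
      have "Im (W n) = y n * (resolvent_sq_int \<nu> (Complex x (y n)) * (cmod (W n))\<^sup>2)"
        using D.Im_recip_cauchy[of "Complex x (y n)"] y by (simp add: W_def)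
      then have "y n * (resolvent_sq_int \<nu> (Complex x (y n)) * ((cmod (W n))\<^sup>2 * poisson_int \<sigma> (W n))) < y n * 1"
        using ImWP[of n] by (simp add: mult_ac)
      then have "resolvent_sq_int \<nu> (Complex x (y n)) * ((cmod (W n))\<^sup>2 * poisson_int \<sigma> (W n)) < 1"
        using y(1)[of n] by (simp only: mult_less_cancel_left_pos)
      moreover have "c * ((cmod (W n))\<^sup>2 * poisson_int \<sigma> (W n))
          \<le> resolvent_sq_int \<nu> (Complex x (y n)) * ((cmod (W n))\<^sup>2 * poisson_int \<sigma> (W n))"
        by (intro mult_right_mono c_le mult_nonneg_nonneg L.poisson_int_nonneg) simp
      ultimately show ?thesis using c by (simp add: pos_le_divide_eq mult.commute)
    qed
    have "\<exists>n. real j < cmod (W n)" for j :: nat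
      using False by (auto simp: bounded_iff not_le)
    then obtain k where k: "\<And>j. real j < cmod (W (k j))" by metis
    have norm_inf: "filterlim (\<lambda>j. cmod (W (k j))) at_top sequentially"
      by (rule filterlim_at_top_mono[OF filterlim_real_sequentially]) (auto intro!: always_eventually less_imp_le k)
    then have W_inf: "filterlim (\<lambda>j. W (k j)) at_infinity sequentially"
      by (rule filterlim_norm_at_top_imp_at_infinity)
    let ?u = "\<lambda>j s. (cmod (W (k j)))\<^sup>2 * poisson_kernel (W (k j)) s"
    have lim: "(\<lambda>j. ?u j s) \<longlonglongrightarrow> 1 + s\<^sup>2" for s
    proof -
      have "(\<lambda>j. of_real s / W (k j)) \<longlonglongrightarrow> 0"
        by (rule tendsto_divide_0[OF tendsto_const W_inf])
      then have "(\<lambda>j. (1 + s\<^sup>2) / (cmod (1 - of_real s / W (k j)))\<^sup>2) \<longlonglongrightarrow> (1 + s\<^sup>2) / (cmod (1 - 0))\<^sup>2"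
        by (intro tendsto_intros) auto
      moreover have "(1 + s\<^sup>2) / (cmod (1 - of_real s / W (k j)))\<^sup>2 = ?u j s" for j
      proof -
        have "W (k j) \<noteq> 0" using W_pos[of "k j"] by auto
        then have "1 - of_real s / W (k j) = (W (k j) - of_real s) / W (k j)"
          by (simp add: diff_divide_distrib)
        then show ?thesis by (simp add: norm_divide power_divide poisson_kernel_def)
      qed
      ultimately show ?thesis by simp
    qed
    have "second_moment_integral \<sigma> = (\<integral>\<^sup>+s. liminf (\<lambda>j. ennreal (?u j s)) \<partial>\<sigma>)"
      unfolding second_moment_integral_def
      by (simp add: lim_imp_Liminf[OF sequentially_bot tendsto_ennrealI[OF lim]] del: ennreal_plus)
    also have "\<dots> \<le> liminf (\<lambda>j. \<integral>\<^sup>+s. ennreal (?u j s) \<partial>\<sigma>)"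
      by (intro nn_integral_liminf) measurable
    also have "\<dots> \<le> ennreal (1 / c)"
    proof (intro Liminf_le always_eventually allI)
      fix j
      have "(\<integral>\<^sup>+s. ennreal (?u j s) \<partial>\<sigma>) = ennreal ((cmod (W (k j)))\<^sup>2 * poisson_int \<sigma> (W (k j)))"
        by (simp add: ennreal_mult nn_integral_cmult L.nn_integral_poisson_kernel[OF W_pos] L.poisson_int_nonneg)
      also have "\<dots> \<le> ennreal (1 / c)" by (intro ennreal_leI bound)
      finally show "(\<integral>\<^sup>+s. ennreal (?u j s) \<partial>\<sigma>) \<le> ennreal (1 / c)" .
    qed simp
    finally show False using mom by (simp add: top_unique)
  qed
qed

end

section \<open>Necessity of the two conditions\<close>

text \<open>The measure \<open>(\<delta>\<^sub>c + \<delta>\<^sub>-\<^sub>c) / 2\<close>, which is the point mass at 0 for \<open>c = 0\<close>.\<close>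

definition two_point_measure :: "real \<Rightarrow> real measure" where
  "two_point_measure c =
     distr (measure_pmf (bernoulli_pmf (1 / 2))) borel (\<lambda>b. if b then c else - c)"

lemma real_distribution_two_point: "real_distribution (two_point_measure c)"
  unfolding two_point_measure_def by (rule prob_space.real_distribution_distr[OF measure_pmf.prob_space_axioms]) simp

lemma recip_cauchy_two_point:
  assumes z: "0 < Im z"
  shows "recip_cauchy (two_point_measure c) z = z - (of_real c)\<^sup>2 / z"
proof -
  have "cauchy_transform (two_point_measure c) z
      = (\<integral>b. 1 / (z - of_real (if b then c else - c)) \<partial>measure_pmf (bernoulli_pmf (1 / 2)))"
    unfolding cauchy_transform_def two_point_measure_def by (intro integral_distr) auto
  also have "\<dots> = (1 / (z - of_real c) + 1 / (z + of_real c)) / 2"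
    by (subst integral_measure_pmf[of UNIV]) (simp_all add: UNIV_bool scaleR_conv_of_real add_divide_distrib ac_simps)
  finally have G: "cauchy_transform (two_point_measure c) z = (1 / (z - of_real c) + 1 / (z + of_real c)) / 2" .
  have ne: "z - of_real c \<noteq> 0" "z + of_real c \<noteq> 0" "z \<noteq> 0"
    using z by (auto simp: complex_eq_iff)
  have "(1 / (z - of_real c) + 1 / (z + of_real c)) / 2 = z / ((z - of_real c) * (z + of_real c))"
    using ne by (simp add: divide_simps)
  then show ?thesis using ne unfolding recip_cauchy_def G
    by (simp add: divide_simps) (simp add: algebra_simps power2_eq_square)
qed

lemma (in finite_borel_measure) poisson_int_le_second_moment:
  assumes fin: "second_moment_integral M \<noteq> \<infinity>" and z: "0 < Im z"
  shows "poisson_int M z \<le> enn2real (second_moment_integral M) / (Im z)\<^sup>2"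
proof -
  have int: "integrable M (\<lambda>s. 1 + s\<^sup>2)"
    using fin by (intro integrableI_nonneg) (auto simp: second_moment_integral_def less_top simp del: ennreal_plus)
  have "poisson_int M z \<le> (\<integral>s. (1 + s\<^sup>2) / (Im z)\<^sup>2 \<partial>M)"
    unfolding poisson_int_def
  proof (intro integral_mono integrable_poisson_kernel z integrable_divide int)
    fix s
    show "poisson_kernel z s \<le> (1 + s\<^sup>2) / (Im z)\<^sup>2"
      unfolding poisson_kernel_def using z upper_ne_real[OF z, of s] Im_le_cmod_diff_real[of z s]
      by (intro divide_left_mono mult_pos_pos power_mono) auto
  qed
  also have "\<dots> = (\<integral>s. 1 + s\<^sup>2 \<partial>M) / (Im z)\<^sup>2" by (rule integral_divide_zero)
  also have "(\<integral>s. 1 + s\<^sup>2 \<partial>M) = enn2real (second_moment_integral M)"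
    unfolding second_moment_integral_def by (intro integral_eq_nn_integral) auto
  finally show ?thesis .
qed

text \<open>For the point mass at 0 one has \<open>F(z) = z\<close>, and \<open>P\<^sub>\<sigma> = 1\<close> on the curve, so the larger boundary
integral exceeds 1. If the second moment integral \<open>m\<close> were finite, the choice \<open>c\<^sup>2 = m\<close> would give
\<open>F(iy) = iv\<close> with \<open>v = (y\<^sup>2 + m) / y\<close>, hence \<open>Im F P\<^sub>\<sigma>(F) \<le> m / v < y\<close> for every \<open>y > 0\<close>, while equality with \<open>y\<close>
must hold where the curve passes over 0.\<close>

lemma (in finite_borel_measure) levy_conditions_if_densities_pos:
  assumes nz: "M \<noteq> null_measure borel"
    and dens: "\<And>\<nu> t. real_distribution \<nu> \<Longrightarrow> 0 < free_conv_density (free_levy_phi \<gamma> M) \<nu> t"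
  shows "1 < boundary_integral M x" "second_moment_integral M = \<infinity>"
proof -
  have loc: "levy_and_distribution M (two_point_measure c)" for c
    by (intro levy_and_distribution.intro levy_and_distribution_axioms.intro
        finite_borel_measure_axioms real_distribution_two_point nz)
  show "1 < boundary_integral M x"
  proof -
    interpret S: levy_and_distribution M "two_point_measure 0" \<gamma> by (rule loc)
    have h: "0 < S.R.height x"
      using dens[OF real_distribution_two_point] by (rule S.height_pos_if_density_pos)
    define y where "y = S.R.height x"
    have "poisson_int S.\<rho> (Complex x y) = 1" using S.R.height_eq_iff[of y x] h by (simp add: y_def)
    then have "poisson_int M (Complex x y) = 1"
      using S.poisson_int_rho[of "Complex x y"] recip_cauchy_two_point[of "Complex x y" 0] h by (simp add: y_def)
    moreover have "poisson_int M (Complex x y) < poisson_int M (Complex x (y / 2))"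
      using h by (intro poisson_int_strict_antimono nz) (auto simp: y_def)
    ultimately have "ennreal 1 < ennreal (poisson_int M (Complex x (y / 2)))"
      by (intro ennreal_lessI) auto
    also have "\<dots> \<le> boundary_integral M x"
      using h by (intro poisson_int_le_boundary_integral) (simp add: y_def)
    finally show ?thesis by simp
  qed
  show "second_moment_integral M = \<infinity>"
  proof (rule ccontr)
    assume fin: "second_moment_integral M \<noteq> \<infinity>"
    define m where "m = enn2real (second_moment_integral M)"
    have m: "0 \<le> m" by (simp add: m_def)
    define c where "c = sqrt m"
    interpret S: levy_and_distribution M "two_point_measure c" \<gamma> by (rule loc)
    have h: "0 < S.R.height 0"
      using dens[OF real_distribution_two_point] by (rule S.height_pos_if_density_pos)
    define y where "y = S.R.height 0"
    have y: "0 < y" using h by (simp add: y_def)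
    define v where "v = (y\<^sup>2 + m) / y"
    have v: "0 < v" using y m by (simp add: v_def add_pos_nonneg)
    have F: "recip_cauchy (two_point_measure c) (Complex 0 y) = Complex 0 v"
      using y m by (simp add: recip_cauchy_two_point c_def v_def complex_eq_iff Re_divide Im_divide
          power2_eq_square field_simps)
    have "poisson_int S.\<rho> (Complex 0 y) = 1" using S.R.height_eq_iff[of y 0] y by (simp add: y_def)
    then have "y = v * poisson_int M (Complex 0 v)"
      using S.poisson_int_rho[of "Complex 0 y"] y by (simp add: F)
    also have "\<dots> \<le> v * (m / v\<^sup>2)"
      using poisson_int_le_second_moment[OF fin, of "Complex 0 v"] v
      by (intro mult_left_mono) (auto simp: m_def)
    also have "\<dots> = m * y / (y\<^sup>2 + m)" using v y by (simp add: v_def power2_eq_square)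
    also have "\<dots> < y"
    proof -
      have "0 < y\<^sup>2 + m" "0 < y * y\<^sup>2" using y m by (simp_all add: add_pos_nonneg)
      then show ?thesis by (simp add: pos_divide_less_eq algebra_simps)
    qed
    finally show False by simp
  qed
qed

theorem theorem3p13:
  fixes \<mu> \<sigma> :: "real measure" and \<gamma> :: real and \<phi> :: "complex \<Rightarrow> complex"
  assumes "free_inf_divisible \<mu>"
    and "is_free_levy_pair \<mu> \<gamma> \<sigma>"
    and "\<sigma> \<noteq> null_measure borel"
  defines "\<phi> \<equiv> free_levy_phi \<gamma> \<sigma>"
  shows "(\<forall>\<nu>. real_distribution \<nu> \<longrightarrow>
            (\<forall>t. free_conv_density \<phi> \<nu> t > 0 \<and> real_analytic_at (free_conv_density \<phi> \<nu>) t))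
     \<longleftrightarrow>
       (\<forall>x. ((\<lambda>\<epsilon>. ereal (Im (\<phi> (Complex x \<epsilon>)) / \<epsilon>))
                 \<longlongrightarrow> - enn2ereal (boundary_integral \<sigma> x)) (at_right 0)
            \<and> boundary_integral \<sigma> x > 1)
     \<and> ((\<lambda>y. ereal (y * Im (\<phi> (Complex 0 y))))
            \<longlongrightarrow> - enn2ereal (second_moment_integral \<sigma>)) at_top
     \<and> second_moment_integral \<sigma> = \<infinity>"
    (is "?dens \<longleftrightarrow> ?cond")
proof
  interpret finite_borel_measure \<sigma> using assms(2) by (simp add: is_free_levy_pair_def)
  show ?cond if ?dens
  proof -
    have dens: "0 < free_conv_density (free_levy_phi \<gamma> \<sigma>) \<nu> t" if "real_distribution \<nu>" for \<nu> t
      using \<open>?dens\<close> that by (simp add: \<phi>_def)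
    show ?thesis
      unfolding \<phi>_def
      by (intro conjI allI free_levy_phi_boundary_limit free_levy_phi_limit_at_infinity
          levy_conditions_if_densities_pos[OF assms(3) dens])
  qed
  show ?dens if cond: ?cond
  proof (intro allI impI)
    fix \<nu> t assume nu: "real_distribution \<nu>"
    interpret S: levy_and_distribution \<sigma> \<nu> \<gamma>
      by (intro levy_and_distribution.intro levy_and_distribution_axioms.intro
          finite_borel_measure_axioms nu assms(3))
    have "0 < S.R.height x" for x using cond by (intro S.height_pos_if_levy_conditions) auto
    then show "free_conv_density \<phi> \<nu> t > 0 \<and> real_analytic_at (free_conv_density \<phi> \<nu>) t"
      unfolding \<phi>_def by (intro conjI S.density_pos_and_analytic)
  qed
qed

end
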